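(* Consider the symmetric Gaussian interfering multiple access channel (IMAC) with parameters $(P_1,P_2,h_1,h_2)$, and let $C_\Sigma$ be its sum capacity. Then $$C_\Sigma\le\overline{C}_\Sigma:=\min_{\substack{\rho\in[-1,1],\ \eta\in\mathbb{R}\setminus\{0\},\\ \eta^2\le 1-\rho^2}}\log\left(1+\frac{1}{\eta^2}\left(\mathsf{INR}+\frac{\mathsf{A}}{1-\rho^2+\mathsf{INR}}\right)\right),$$ where $\mathsf{INR}=h_1^2P_1+h_2^2P_2$ and $$\mathsf{A}=\mathsf{A}(\rho,\eta)=P_1(\eta-\rho h_1)^2+P_2(\eta-\rho h_2)^2+P_1P_2(h_1-h_2)^2.$$
   Context: Channel model. Let $P_1,P_2\ge 0$ and $h_1,h_2\in\mathbb{R}$; put $P_3=P_1$, $P_4=P_2$. The IMAC with parameters $(P_1,P_2,h_1,h_2)$ is the memoryless channel with four real inputs $X_1,\dots,X_4$ and two real outputs $$Y_1=X_1+X_2+h_1X_3+h_2X_4+Z_1,\qquad Y_2=h_1X_1+h_2X_2+X_3+X_4+Z_2,$$ where $Z_1,Z_2\sim\mathcal{N}(0,1)$ are independent of each other, i.i.d. over time, and independent of the inputs. Transmitters 1 and 2 have messages for receiver 1 (observing $Y_1$); transmitters 3 and 4 have messages for receiver 2 (observing $Y_2$). Codes and capacity. An $(n,2^{nR_1},2^{nR_2},2^{nR_3},2^{nR_4})$ code consists of message sets $\mathcal{M}_i=\{1,\dots,2^{nR_i}\}$ (with $2^{nR_i}$ rounded up to an integer), encoders $f_i:\mathcal{M}_i\to\mathbb{R}^n$,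 $i=1,2,3,4$, and decoders $g_i:\mathbb{R}^n\to\mathcal{M}_i$, with $g_1,g_2$ applied to $Y_1^n$ and $g_3,g_4$ applied to $Y_2^n$. The messages $M_i$ are independent and uniform on $\mathcal{M}_i$, $X_i^n=f_i(M_i)$, and the average power constraints $\frac1n\sum_{t=1}^n\mathbb{E}[X_{i,t}^2]\le P_i$ must hold for $i=1,2,3,4$. With $\hat M_i$ the decoder outputs, the error probability is $P_e^{(n)}=P(\hat M_i\ne M_i\text{ for some }i)$. A tuple $(R_1,R_2,R_3,R_4)$ of nonnegative reals is achievable if there is a sequence of such codes with $P_e^{(n)}\to0$ as $n\to\infty$. The capacity region $\mathcal{C}$ is the closure of the set of achievable tuples, and the sum capacity is $C_\Sigma=\max_{(R_1,R_2,R_3,R_4)\in\mathcal{C}}(R_1+R_2+R_3+R_4)$. Logarithms are to base 2. *)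

theory Defs
  imports "HOL-Probability.Probability"
begin

text \<open>
  Transmitters are indexed by the four-element type \<^typ>\<open>4\<close>, whose numerals are read modulo 4:
  transmitter 4 is the element \<open>0\<close>, and 1, 2, 3, 4 are its four distinct elements.
  Length-\<open>n\<close> blocks are functions \<^typ>\<open>nat \<Rightarrow> real\<close> restricted to the times \<open>{..<n}\<close>.
\<close>

definition tx_power :: "real \<Rightarrow> real \<Rightarrow> 4 \<Rightarrow> real" where
  "tx_power P1 P2 i = (if i = 1 \<or> i = 3 then P1 else P2)"

definition message_set :: "nat \<Rightarrow> real \<Rightarrow> nat set" where
  "message_set n r = {1..nat \<lceil>2 powr (real n * r)\<rceil>}"

definition message_law :: "nat \<Rightarrow> real \<Rightarrow> nat pmf" where
  "message_law n r = pmf_of_set (message_set n r)"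

definition noise_law :: "nat \<Rightarrow> (nat \<Rightarrow> real) measure" where
  "noise_law n = (\<Pi>\<^sub>M t\<in>{..<n}. density lborel (\<lambda>x. ennreal (std_normal_density x)))"

text \<open>
  The joint law of the messages and of the noises at the two receivers, all independent. The
  default value \<open>0\<close> given to \<^const>\<open>Pi_pmf\<close> plays no role, as the index set is \<^const>\<open>UNIV\<close>.
\<close>

definition imac_space ::
  "nat \<Rightarrow> real ^ 4 \<Rightarrow> ((4 \<Rightarrow> nat) \<times> (nat \<Rightarrow> real) \<times> (nat \<Rightarrow> real)) measure" where
  "imac_space n R =
     measure_pmf (Pi_pmf UNIV 0 (\<lambda>i. message_law n (R $ i))) \<Otimes>\<^sub>M (noise_law n \<Otimes>\<^sub>M noise_law n)"

definition output1 ::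
  "nat \<Rightarrow> real \<Rightarrow> real \<Rightarrow> (4 \<Rightarrow> nat \<Rightarrow> real) \<Rightarrow> (nat \<Rightarrow> real) \<Rightarrow> nat \<Rightarrow> real" where
  "output1 n h1 h2 x z = (\<lambda>t\<in>{..<n}. x 1 t + x 2 t + h1 * x 3 t + h2 * x 4 t + z t)"

definition output2 ::
  "nat \<Rightarrow> real \<Rightarrow> real \<Rightarrow> (4 \<Rightarrow> nat \<Rightarrow> real) \<Rightarrow> (nat \<Rightarrow> real) \<Rightarrow> nat \<Rightarrow> real" where
  "output2 n h1 h2 x z = (\<lambda>t\<in>{..<n}. h1 * x 1 t + h2 * x 2 t + x 3 t + x 4 t + z t)"

text \<open>
  The encoder \<open>f i\<close> maps a message and a time to a channel input; the decoder \<open>g i\<close> maps a received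
  block to a message. Decoders are measurable, so that the error event has a probability.
\<close>

definition is_code ::
  "real \<Rightarrow> real \<Rightarrow> nat \<Rightarrow> real ^ 4 \<Rightarrow> (4 \<Rightarrow> nat \<Rightarrow> nat \<Rightarrow> real) \<Rightarrow> (4 \<Rightarrow> (nat \<Rightarrow> real) \<Rightarrow> nat) \<Rightarrow> bool"
where
  "is_code P1 P2 n R f g \<longleftrightarrow>
     (\<forall>i. g i \<in> (\<Pi>\<^sub>M t\<in>{..<n}. borel) \<rightarrow>\<^sub>M count_space (message_set n (R $ i))) \<and>
     (\<forall>i. (\<Sum>t<n. measure_pmf.expectation (message_law n (R $ i)) (\<lambda>m. (f i m t)\<^sup>2)) / real n
            \<le> tx_power P1 P2 i)"

definition decoded ::
  "real \<Rightarrow> real \<Rightarrow> nat \<Rightarrow> (4 \<Rightarrow> nat \<Rightarrow> nat \<Rightarrow> real) \<Rightarrow> (4 \<Rightarrow> (nat \<Rightarrow> real) \<Rightarrow> nat) \<Rightarrow>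
   (4 \<Rightarrow> nat) \<times> (nat \<Rightarrow> real) \<times> (nat \<Rightarrow> real) \<Rightarrow> 4 \<Rightarrow> nat" where
  "decoded h1 h2 n f g = (\<lambda>(m, z1, z2) i.
     if i = 1 \<or> i = 2 then g i (output1 n h1 h2 (\<lambda>j. f j (m j)) z1)
     else g i (output2 n h1 h2 (\<lambda>j. f j (m j)) z2))"

definition error_prob ::
  "real \<Rightarrow> real \<Rightarrow> nat \<Rightarrow> real ^ 4 \<Rightarrow> (4 \<Rightarrow> nat \<Rightarrow> nat \<Rightarrow> real) \<Rightarrow> (4 \<Rightarrow> (nat \<Rightarrow> real) \<Rightarrow> nat) \<Rightarrow> real"
where
  "error_prob h1 h2 n R f g =
     \<P>(\<omega> in imac_space n R. \<exists>i. decoded h1 h2 n f g \<omega> i \<noteq> fst \<omega> i)"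

definition achievable :: "real \<Rightarrow> real \<Rightarrow> real \<Rightarrow> real \<Rightarrow> real ^ 4 \<Rightarrow> bool" where
  "achievable P1 P2 h1 h2 R \<longleftrightarrow>
     (\<forall>i. 0 \<le> R $ i) \<and>
     (\<exists>f g. (\<forall>n\<ge>1. is_code P1 P2 n R (f n) (g n)) \<and>
            (\<lambda>n. error_prob h1 h2 n R (f n) (g n)) \<longlonglongrightarrow> 0)"

definition capacity_region :: "real \<Rightarrow> real \<Rightarrow> real \<Rightarrow> real \<Rightarrow> (real ^ 4) set" where
  "capacity_region P1 P2 h1 h2 = closure {R. achievable P1 P2 h1 h2 R}"

definition sum_rate :: "real ^ 4 \<Rightarrow> real" where
  "sum_rate R = (\<Sum>i\<in>UNIV. R $ i)"

definition sum_capacity :: "real \<Rightarrow> real \<Rightarrow> real \<Rightarrow> real \<Rightarrow> real" where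
  "sum_capacity P1 P2 h1 h2 = (GREATEST c. c \<in> sum_rate ` capacity_region P1 P2 h1 h2)"

definition INR :: "real \<Rightarrow> real \<Rightarrow> real \<Rightarrow> real \<Rightarrow> real" where
  "INR P1 P2 h1 h2 = h1\<^sup>2 * P1 + h2\<^sup>2 * P2"

definition bound_A :: "real \<Rightarrow> real \<Rightarrow> real \<Rightarrow> real \<Rightarrow> real \<Rightarrow> real \<Rightarrow> real" where
  "bound_A P1 P2 h1 h2 \<rho> \<eta> =
     P1 * (\<eta> - \<rho> * h1)\<^sup>2 + P2 * (\<eta> - \<rho> * h2)\<^sup>2 + P1 * P2 * (h1 - h2)\<^sup>2"

definition bound_values :: "real \<Rightarrow> real \<Rightarrow> real \<Rightarrow> real \<Rightarrow> real set" where
  "bound_values P1 P2 h1 h2 =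
     {log 2 (1 + 1 / \<eta>\<^sup>2 * (INR P1 P2 h1 h2 +
               bound_A P1 P2 h1 h2 \<rho> \<eta> / (1 - \<rho>\<^sup>2 + INR P1 P2 h1 h2))) |
      \<rho> \<eta>. \<rho> \<in> {-1..1} \<and> \<eta> \<noteq> 0 \<and> \<eta>\<^sup>2 \<le> 1 - \<rho>\<^sup>2}"

definition sum_capacity_bound :: "real \<Rightarrow> real \<Rightarrow> real \<Rightarrow> real \<Rightarrow> real" where
  "sum_capacity_bound P1 P2 h1 h2 = (LEAST v. v \<in> bound_values P1 P2 h1 h2)"

end

theory Submission
  imports Defs
begin

text \<open>
  Genie-aided converse. With \<open>w ~ N(0, \<eta>\<^sup>2)\<close> and receiver noise \<open>Z = (\<rho> / \<eta>) w + N\<close>, where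
  \<open>N ~ N(0, 1 - \<rho>\<^sup>2)\<close> is independent of \<open>w\<close>, a genie hands receiver 1 the block
  \<open>S\<^sub>1 = h\<^sub>1 X\<^sub>1 + h\<^sub>2 X\<^sub>2 + w\<close>, and receiver 2 its mirror image. Given its own codewords and \<open>S\<^sub>1\<close>,
  receiver 1 is left with the uncertainty of \<open>T\<^sub>2 = h\<^sub>1 X\<^sub>3 + h\<^sub>2 X\<^sub>4 + N\<close>. In the sum of the two
  Fano bounds, \<open>h(S\<^sub>1)\<close> therefore meets \<open>h(T\<^sub>1)\<close>; since \<open>\<eta>\<^sup>2 \<le> 1 - \<rho>\<^sup>2\<close>, the variable \<open>T\<^sub>1\<close> is \<open>S\<^sub>1\<close>
  plus Gaussian noise, and \<open>h(S\<^sub>1) - h(T\<^sub>1)\<close> is largest for Gaussian inputs. The remaining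
  \<open>h(Y\<^sub>1 | S\<^sub>1)\<close> is bounded through the linear estimator \<open>c S\<^sub>1\<close> of \<open>Y\<^sub>1\<close>.

  All entropies are those of finite Gaussian mixtures, and each entropy inequality is one application
  of the Gibbs inequality \<open>E ln (Q / P) \<le> 0\<close> to a suitable test density \<open>Q\<close>. The same test densities
  serve at all times, so no single-letterization is needed.
\<close>

section \<open>Gaussian vectors\<close>

text \<open>The coefficient \<open>\<rho> / \<eta>\<close> gives Z variance
  \<open>\<rho>\<^sup>2 + (1 - \<rho>\<^sup>2) = 1\<close> and correlation \<rho> with
  \<open>w / \<eta>\<close>. Since \<eta> is nonzero, the constraint forces
  \<open>\<rho>\<^sup>2 < 1\<close>; both w and N are then nondegenerate, every density in play is
  strictly positive and every logarithm is finite. Messages are uniform on finite sets, so an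
  expectation is an average over messages of an integral against the noise law alone. In each use of
  the Gibbs inequality, the sum over messages meets a quotient of a translated Gaussian by the
  mixture of all of them, and collapses to a constant. The obstacle is the power constraint: it
  bounds second moments, whereas cross terms between different transmitters vanish only for
  codebooks of mean zero. The codebooks are therefore centred at each time, which does not raise
  their power, and the decoders add the known means back. The estimator coefficient c stays free
  until the end; the value minimizing the variance of \<open>Y - c S\<close> at full power produces
  the term \<open>bound_A\<close>.\<close>

definition block_lborel :: "nat \<Rightarrow> (nat \<Rightarrow> real) measure" where
  "block_lborel n = (\<Pi>\<^sub>M t\<in>{..<n}. lborel)"

text \<open>Here v is the variance, while \<open>normal_density\<close> takes the standard
  deviation. Only coordinates below n are read, so arguments such as
  \<open>\<lambda>t. x t - k a t\<close> need not be extensional, unlike the points of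
  \<open>block_lborel n\<close>.\<close>

definition gauss :: "nat \<Rightarrow> real \<Rightarrow> (nat \<Rightarrow> real) \<Rightarrow> real" where
  "gauss n v x = (\<Prod>t<n. normal_density 0 (sqrt v) (x t))"

definition gauss_measure :: "nat \<Rightarrow> real \<Rightarrow> (nat \<Rightarrow> real) measure" where
  "gauss_measure n v = density (block_lborel n) (\<lambda>x. ennreal (gauss n v x))"

text \<open>The density of a codeword \<open>k a\<close>, with \<open>a\<close> uniform on
  \<open>A\<close>, plus independent Gaussian noise of variance v per coordinate.\<close>

definition mixture :: "nat \<Rightarrow> real \<Rightarrow> 'a set \<Rightarrow> ('a \<Rightarrow> nat \<Rightarrow> real) \<Rightarrow> (nat \<Rightarrow> real) \<Rightarrow> real" where
  "mixture n v A k x = (\<Sum>a\<in>A. gauss n v (\<lambda>t. x t - k a t)) / card A"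

interpretation lborel_product: product_sigma_finite "\<lambda>_::nat. lborel :: real measure" ..

lemma sigma_finite_block_lborel: "sigma_finite_measure (block_lborel n)"
  unfolding block_lborel_def by (rule lborel_product.sigma_finite) simp

lemma space_block_lborel: "space (block_lborel n) = {..<n} \<rightarrow>\<^sub>E UNIV"
  by (simp add: block_lborel_def space_PiM)

lemma sets_block_lborel: "sets (block_lborel n) = sets (\<Pi>\<^sub>M t\<in>{..<n}. borel)"
  unfolding block_lborel_def by (rule sets_PiM_cong) auto

lemma sets_gauss_measure [measurable_cong]: "sets (gauss_measure n v) = sets (block_lborel n)"
  by (simp add: gauss_measure_def)

lemma space_gauss_measure: "space (gauss_measure n v) = space (block_lborel n)"
  by (simp add: gauss_measure_def)

lemma block_component_measurable:
  "t < n \<Longrightarrow> (\<lambda>x. x t) \<in> borel_measurable (block_lborel n)"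
  unfolding block_lborel_def by measurable

lemma measurable_block_restrict:
  "(\<And>t. t < n \<Longrightarrow> (\<lambda>x. f x t) \<in> borel_measurable M) \<Longrightarrow>
    (\<lambda>x. restrict (f x) {..<n}) \<in> M \<rightarrow>\<^sub>M block_lborel n"
  unfolding block_lborel_def restrict_def[abs_def]
  by (rule measurable_restrict[unfolded restrict_def]) auto

lemma gauss_measurable:
  "(\<And>t. t < n \<Longrightarrow> (\<lambda>x. f x t) \<in> borel_measurable M) \<Longrightarrow>
    (\<lambda>x. gauss n v (f x)) \<in> borel_measurable M"
  unfolding gauss_def
  by (intro borel_measurable_prod measurable_compose[OF _ borel_measurable_normal_density]) auto

lemma mixture_measurable:
  "(\<And>t. t < n \<Longrightarrow> (\<lambda>x. f x t) \<in> borel_measurable M) \<Longrightarrow>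
    (\<lambda>x. mixture n v A k (f x)) \<in> borel_measurable M"
  unfolding mixture_def
  by (intro borel_measurable_divide borel_measurable_sum gauss_measurable) auto

lemma gauss_cong: "(\<And>t. t < n \<Longrightarrow> x t = y t) \<Longrightarrow> gauss n v x = gauss n v y"
  by (simp add: gauss_def)

lemma mixture_cong: "(\<And>t. t < n \<Longrightarrow> x t = y t) \<Longrightarrow> mixture n v A k x = mixture n v A k y"
  unfolding mixture_def by (intro arg_cong2[where f="(/)"] sum.cong gauss_cong) auto

lemma gauss_nonneg: "0 \<le> gauss n v x"
  by (simp add: gauss_def prod_nonneg)

lemma gauss_pos: "0 < v \<Longrightarrow> 0 < gauss n v x"
  by (simp add: gauss_def prod_pos normal_density_pos)

lemma mixture_nonneg: "0 \<le> mixture n v A k x"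
  by (simp add: mixture_def sum_nonneg gauss_nonneg)

lemma mixture_pos: "finite A \<Longrightarrow> A \<noteq> {} \<Longrightarrow> 0 < v \<Longrightarrow> 0 < mixture n v A k x"
  unfolding mixture_def by (intro divide_pos_pos sum_pos gauss_pos) (auto simp: card_gt_0_iff)

lemma ln_gauss:
  assumes "0 < v"
  shows "ln (gauss n v x) = - (real n / 2 * ln (2 * pi * v)) - (\<Sum>t<n. (x t)\<^sup>2) / (2 * v)"
proof -
  have "ln (gauss n v x) = (\<Sum>t<n. ln (normal_density 0 (sqrt v) (x t)))"
    unfolding gauss_def using assms by (subst ln_prod) (auto simp: normal_density_pos less_imp_neq[symmetric])
  also have "\<dots> = (\<Sum>t<n. - (ln (2 * pi * v) / 2) - (x t)\<^sup>2 / (2 * v))"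
  proof (rule sum.cong)
    fix t
    have "normal_density 0 (sqrt v) (x t) = exp (- (x t)\<^sup>2 / (2 * v)) / sqrt (2 * pi * v)"
      using assms by (simp add: normal_density_def)
    then show "ln (normal_density 0 (sqrt v) (x t)) = - (ln (2 * pi * v) / 2) - (x t)\<^sup>2 / (2 * v)"
      using assms by (simp add: ln_div ln_sqrt)
  qed simp
  finally show ?thesis
    by (simp add: sum_subtractf sum_negf sum_divide_distrib)
qed

text \<open>The peak value of the density; it bounds the logarithm of a mixture from above.\<close>

lemma gauss_le:
  assumes "0 < v"
  shows "gauss n v x \<le> exp (- (real n / 2 * ln (2 * pi * v)))"
proof -
  have "ln (gauss n v x) \<le> - (real n / 2 * ln (2 * pi * v))"
    using assms by (simp add: ln_gauss sum_nonneg)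
  then show ?thesis
    using gauss_pos[OF assms] by (metis exp_le_cancel_iff exp_ln)
qed

section \<open>Normalization, product form and translation of Gaussian densities\<close>

lemma nn_integral_gauss:
  assumes "0 < v"
  shows "(\<integral>\<^sup>+ x. ennreal (gauss n v x) \<partial>block_lborel n) = 1"
proof -
  have "(\<integral>\<^sup>+ x. ennreal (gauss n v x) \<partial>block_lborel n) =
      (\<integral>\<^sup>+ x. (\<Prod>t<n. ennreal (normal_density 0 (sqrt v) (x t))) \<partial>block_lborel n)"
    by (simp add: gauss_def prod_ennreal)
  also have "\<dots> = (\<Prod>t<n. \<integral>\<^sup>+ x. ennreal (normal_density 0 (sqrt v) x) \<partial>lborel)"
    unfolding block_lborel_def by (rule lborel_product.product_nn_integral_prod) auto
  also have "(\<integral>\<^sup>+ x. ennreal (normal_density 0 (sqrt v) x) \<partial>lborel) = 1"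
    using assms by (subst nn_integral_eq_integral) auto
  finally show ?thesis by simp
qed

text \<open>Connects the density form, in which translations and mixtures are computed, with the
  product form of the noise law. Rectangles determine a product measure, and on them the density
  factorizes.\<close>

lemma gauss_measure_eq_PiM:
  assumes "0 < v"
  shows "gauss_measure n v =
    (\<Pi>\<^sub>M t\<in>{..<n}. density lborel (\<lambda>x. ennreal (normal_density 0 (sqrt v) x)))"
proof -
  let ?N = "density lborel (\<lambda>x. ennreal (normal_density 0 (sqrt v) x))"
  have "prob_space ?N"
    using assms by (intro prob_space_normal_density) simp
  then interpret product_sigma_finite "\<lambda>_::nat. ?N"
    by (intro product_sigma_finite.intro prob_space_imp_sigma_finite)
  show ?thesis
  proof (rule PiM_eqI)
    show "sets (gauss_measure n v) = sets (\<Pi>\<^sub>M t\<in>{..<n}. ?N)"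
      unfolding sets_gauss_measure block_lborel_def by (rule sets_PiM_cong) auto
    fix E :: "nat \<Rightarrow> real set"
    assume E: "\<And>i. i \<in> {..<n} \<Longrightarrow> E i \<in> sets ?N"
    have "Pi\<^sub>E {..<n} E \<in> sets (block_lborel n)"
      unfolding block_lborel_def using E by (intro sets_PiM_I_finite) auto
    moreover have "(\<lambda>x. ennreal (gauss n v x)) \<in> borel_measurable (block_lborel n)"
      by (intro measurable_compose[OF gauss_measurable measurable_ennreal]
          block_component_measurable)
    ultimately have "emeasure (gauss_measure n v) (Pi\<^sub>E {..<n} E) =
        (\<integral>\<^sup>+ x. ennreal (gauss n v x) * indicator (Pi\<^sub>E {..<n} E) x \<partial>block_lborel n)"
      by (simp add: gauss_measure_def emeasure_density)
    also have "\<dots> = (\<integral>\<^sup>+ x. (\<Prod>t<n. ennreal (normal_density 0 (sqrt v) (x t)) * indicator (E t) (x t))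
        \<partial>block_lborel n)"
    proof (rule nn_integral_cong)
      fix x assume "x \<in> space (block_lborel n)"
      then have "indicator (Pi\<^sub>E {..<n} E) x = (\<Prod>t<n. indicator (E t) (x t) :: ennreal)"
        by (auto simp: indicator_def space_block_lborel PiE_iff prod_zero_iff intro!: prod.neutral)
      then show "ennreal (gauss n v x) * indicator (Pi\<^sub>E {..<n} E) x =
          (\<Prod>t<n. ennreal (normal_density 0 (sqrt v) (x t)) * indicator (E t) (x t))"
        by (simp add: gauss_def prod.distrib prod_ennreal)
    qed
    also have "\<dots> = (\<Prod>t<n. \<integral>\<^sup>+ x. ennreal (normal_density 0 (sqrt v) x) * indicator (E t) x \<partial>lborel)"
      unfolding block_lborel_def using E by (intro lborel_product.product_nn_integral_prod) auto
    also have "\<dots> = (\<Prod>t<n. emeasure ?N (E t))"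
      using E by (intro prod.cong) (auto simp: emeasure_density)
    finally show "emeasure (gauss_measure n v) (Pi\<^sub>E {..<n} E) = (\<Prod>i<n. emeasure ?N (E i))" .
  qed simp
qed

lemma noise_law_eq: "noise_law n = gauss_measure n 1"
  by (simp add: noise_law_def gauss_measure_eq_PiM)

lemma prob_space_gauss_measure:
  assumes "0 < v"
  shows "prob_space (gauss_measure n v)"
  unfolding gauss_measure_eq_PiM[OF assms] using assms
  by (intro prob_space_PiM prob_space_normal_density) simp

lemma nn_integral_gauss_measure:
  assumes "f \<in> borel_measurable (block_lborel n)"
  shows "(\<integral>\<^sup>+ x. f x \<partial>gauss_measure n v) = (\<integral>\<^sup>+ x. ennreal (gauss n v x) * f x \<partial>block_lborel n)"
  unfolding gauss_measure_def
  by (rule nn_integral_density) (auto intro!: measurable_compose[OF gauss_measurable measurable_ennreal]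
          block_component_measurable assms)

text \<open>The translate of an extensional function is in general not extensional, hence the
  condition that \<open>F\<close> ignores coordinates outside \<open>{..<n}\<close>. On rectangles
  the claim reduces to translation invariance on the line.\<close>

lemma nn_integral_block_translate:
  assumes F: "F \<in> borel_measurable (block_lborel n)"
    and "\<And>x. F (restrict x {..<n}) = F x"
  shows "(\<integral>\<^sup>+ x. F (\<lambda>t. a t + x t) \<partial>block_lborel n) = (\<integral>\<^sup>+ x. F x \<partial>block_lborel n)"
proof -
  let ?T = "\<lambda>x. restrict (\<lambda>t. a t + x t) {..<n}"
  have T: "?T \<in> block_lborel n \<rightarrow>\<^sub>M block_lborel n"
    by (intro measurable_block_restrict borel_measurable_add borel_measurable_const
        block_component_measurable)
  have "distr (block_lborel n) (block_lborel n) ?T = (\<Pi>\<^sub>M t\<in>{..<n}. lborel)"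
  proof (rule lborel_product.PiM_eqI)
    fix E :: "nat \<Rightarrow> real set"
    assume E: "\<And>i. i \<in> {..<n} \<Longrightarrow> E i \<in> sets lborel"
    have "emeasure (distr (block_lborel n) (block_lborel n) ?T) (Pi\<^sub>E {..<n} E) =
        emeasure (block_lborel n) (?T -` (Pi\<^sub>E {..<n} E) \<inter> space (block_lborel n))"
      using E T by (intro emeasure_distr) (auto simp: block_lborel_def intro!: sets_PiM_I_finite)
    also have "?T -` (Pi\<^sub>E {..<n} E) \<inter> space (block_lborel n) =
        Pi\<^sub>E {..<n} (\<lambda>t. (\<lambda>x. a t + x) -` E t)"
      by (auto simp: space_block_lborel PiE_iff)
    also have "emeasure (block_lborel n) \<dots> = (\<Prod>t<n. emeasure lborel ((\<lambda>x. a t + x) -` E t))"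
      unfolding block_lborel_def
    proof (rule lborel_product.emeasure_PiM)
      show "(\<lambda>x. a t + x) -` E t \<in> sets lborel" if "t \<in> {..<n}" for t
        using measurable_sets[of "\<lambda>x. a t + x" lborel lborel "E t"] E[OF that] by simp
    qed simp
    also have "\<dots> = (\<Prod>t<n. emeasure lborel (E t))"
    proof (rule prod.cong)
      fix t assume "t \<in> {..<n}"
      then have "emeasure lborel (E t) = emeasure (distr lborel borel ((+) (a t))) (E t)"
        by (simp add: lborel_distr_plus)
      also have "\<dots> = emeasure lborel ((\<lambda>x. a t + x) -` E t)"
        using E[OF \<open>t \<in> {..<n}\<close>] by (subst emeasure_distr) auto
      finally show "emeasure lborel ((\<lambda>x. a t + x) -` E t) = emeasure lborel (E t)" by simp
    qed simp
    finally show "emeasure (distr (block_lborel n) (block_lborel n) ?T) (Pi\<^sub>E {..<n} E) =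
        (\<Prod>i<n. emeasure lborel (E i))" .
  qed (simp_all add: block_lborel_def)
  then have "(\<integral>\<^sup>+ x. F x \<partial>block_lborel n) =
      (\<integral>\<^sup>+ x. F x \<partial>distr (block_lborel n) (block_lborel n) ?T)"
    by (simp add: block_lborel_def)
  also have "\<dots> = (\<integral>\<^sup>+ x. F (?T x) \<partial>block_lborel n)"
    using T F by (simp add: nn_integral_distr)
  finally show ?thesis using assms(2) by simp
qed

text \<open>Bayes' rule for \<open>y = l * x + noise\<close> with x of variance p and noise of
  variance q: y has variance r, and given y the variable x is Gaussian with mean
  \<open>l * p / r * y\<close> and variance \<open>p * q / r\<close>.\<close>

lemma normal_density_conditioning:
  fixes p q l x y :: real
  assumes "0 < p" "0 < q"
  defines "r \<equiv> q + l\<^sup>2 * p"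
  shows "normal_density 0 (sqrt p) x * normal_density 0 (sqrt q) (y - l * x) =
    normal_density 0 (sqrt r) y * normal_density 0 (sqrt (p * q / r)) (x - l * p / r * y)"
proof -
  have r: "0 < r" using assms by (simp add: add_pos_nonneg)
  have nd: "normal_density 0 (sqrt v) z = exp (- (z\<^sup>2 / (2 * v))) / sqrt (2 * pi * v)" if "0 < v" for v z
    using that by (simp add: normal_density_def)
  have "sqrt (2 * pi * p) * sqrt (2 * pi * q) = sqrt (2 * pi * r) * sqrt (2 * pi * (p * q / r))"
    using r by (simp flip: real_sqrt_mult)
  moreover have "x\<^sup>2 / (2 * p) + (y - l * x)\<^sup>2 / (2 * q) =
      y\<^sup>2 / (2 * r) + (x - l * p / r * y)\<^sup>2 / (2 * (p * q / r))"
  proof -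
    \<comment> \<open>Completing the square, cleared of denominators.\<close>
    have "r * (q * x\<^sup>2 + p * (y - l * x)\<^sup>2) = p * q * y\<^sup>2 + (r * x - l * p * y)\<^sup>2"
      unfolding r_def by (simp add: power2_eq_square algebra_simps)
    moreover have "(x - l * p / r * y)\<^sup>2 / (2 * (p * q / r)) = (r * x - l * p * y)\<^sup>2 / (2 * p * q * r)"
    proof -
      have "x - l * p / r * y = (r * x - l * p * y) / r"
        using r by (simp add: field_simps)
      then show ?thesis using r assms(1,2) by (simp add: power_divide field_simps power2_eq_square)
    qed
    moreover have "x\<^sup>2 / (2 * p) + (y - l * x)\<^sup>2 / (2 * q) = r * (q * x\<^sup>2 + p * (y - l * x)\<^sup>2) / (2 * p * q * r)"
      "y\<^sup>2 / (2 * r) = p * q * y\<^sup>2 / (2 * p * q * r)"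
      using r assms(1,2) by (simp_all add: field_simps)
    ultimately show ?thesis
      by (simp add: add_divide_distrib)
  qed
  ultimately show ?thesis
    using assms(1,2) r by (simp add: nd flip: exp_add minus_add_distrib)
qed

lemma gauss_conditioning:
  fixes p q l :: real
  assumes "0 < p" "0 < q"
  defines "r \<equiv> q + l\<^sup>2 * p"
  shows "gauss n p x * gauss n q (\<lambda>t. y t - l * x t) =
    gauss n r y * gauss n (p * q / r) (\<lambda>t. x t - l * p / r * y t)"
  unfolding gauss_def prod.distrib[symmetric] r_def
  by (intro prod.cong normal_density_conditioning assms refl)

lemma gauss_measure_second_moment:
  assumes "0 < v" "t < n"
  shows "integrable (gauss_measure n v) (\<lambda>x. (e + c * x t)\<^sup>2)"
    and "(\<integral>x. (e + c * x t)\<^sup>2 \<partial>gauss_measure n v) = e\<^sup>2 + c\<^sup>2 * v"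
proof -
  let ?N = "density lborel (\<lambda>x. ennreal (normal_density 0 (sqrt v) x))"
  have s: "0 < sqrt v" using assms by simp
  have "prob_space ?N"
    using s by (rule prob_space_normal_density)
  have *: "distr (gauss_measure n v) ?N (\<lambda>x. x t) = ?N"
    unfolding gauss_measure_eq_PiM[OF assms(1)]
    using assms by (intro distr_PiM_component prob_space_normal_density s) auto
  have m: "(\<lambda>x. x t) \<in> gauss_measure n v \<rightarrow>\<^sub>M ?N"
    using block_component_measurable[OF assms(2)] by (simp add: gauss_measure_def)
  have B: "has_bochner_integral ?N (\<lambda>x. (e + c * x)\<^sup>2) (e\<^sup>2 + c\<^sup>2 * v)"
  proof -
    \<comment> \<open>The three instances are the moments of order 0, 1 and 2.\<close>
    note normal_moment_even[OF s, of 0 0] normal_moment_odd[OF s, of 0 0]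
      normal_moment_even[OF s, of 0 1]
    then have "has_bochner_integral lborel (\<lambda>x. normal_density 0 (sqrt v) x * e\<^sup>2 +
        (normal_density 0 (sqrt v) x * x * (2 * e * c) + normal_density 0 (sqrt v) x * x\<^sup>2 * c\<^sup>2))
        (1 * e\<^sup>2 + (0 * (2 * e * c) + v * c\<^sup>2))"
      using assms(1) by (intro has_bochner_integral_add has_bochner_integral_mult_left)
        (simp_all add: fact_numeral)
    then show ?thesis
      by (subst has_bochner_integral_density) (auto simp: power2_eq_square algebra_simps)
  qed
  show "integrable (gauss_measure n v) (\<lambda>x. (e + c * x t)\<^sup>2)"
    using integrable_distr[OF m, of "\<lambda>x. (e + c * x)\<^sup>2"] B unfolding *
    by (simp add: has_bochner_integral_iff)
  show "(\<integral>x. (e + c * x t)\<^sup>2 \<partial>gauss_measure n v) = e\<^sup>2 + c\<^sup>2 * v"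
    using integral_distr[OF m, of "\<lambda>x. (e + c * x)\<^sup>2"] B unfolding *
    by (simp add: has_bochner_integral_iff)
qed

section \<open>Pairs of independent Gaussian vectors\<close>

abbreviation noise_pair ::
  "nat \<Rightarrow> real \<Rightarrow> real \<Rightarrow> ((nat \<Rightarrow> real) \<times> (nat \<Rightarrow> real)) measure" where
  "noise_pair n p q \<equiv> gauss_measure n p \<Otimes>\<^sub>M gauss_measure n q"

lemma prob_space_noise_pair:
  "0 < p \<Longrightarrow> 0 < q \<Longrightarrow> prob_space (noise_pair n p q)"
  by (intro prob_space_pair prob_space_gauss_measure)

lemma sets_noise_pair: "sets (noise_pair n p q) = sets (block_lborel n \<Otimes>\<^sub>M block_lborel n)"
  by (intro sets_pair_measure_cong sets_gauss_measure)

lemma fst_component_measurable: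
  "t < n \<Longrightarrow> (\<lambda>z. fst z t) \<in> borel_measurable (block_lborel n \<Otimes>\<^sub>M block_lborel n)"
  by (rule measurable_compose[OF measurable_fst block_component_measurable])

lemma snd_component_measurable:
  "t < n \<Longrightarrow> (\<lambda>z. snd z t) \<in> borel_measurable (block_lborel n \<Otimes>\<^sub>M block_lborel n)"
  by (rule measurable_compose[OF measurable_snd block_component_measurable])

lemma measurable_noise_pair:
  "f \<in> borel_measurable (block_lborel n \<Otimes>\<^sub>M block_lborel n) \<Longrightarrow> f \<in> borel_measurable (noise_pair n p q)"
  using measurable_cong_sets[OF sets_noise_pair refl] by blast

text \<open>Passing to iterated Lebesgue integrals makes changes of variables available:
  translations and swaps of the integration order.\<close>

lemma nn_integral_noise_pair:
  assumes F: "F \<in> borel_measurable (block_lborel n \<Otimes>\<^sub>M block_lborel n)" and "0 < p" "0 < q"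
  shows "(\<integral>\<^sup>+ z. F z \<partial>noise_pair n p q) =
    (\<integral>\<^sup>+ x. \<integral>\<^sup>+ y. ennreal (gauss n p x * gauss n q y) * F (x, y) \<partial>block_lborel n \<partial>block_lborel n)"
proof -
  interpret Q: prob_space "gauss_measure n q"
    using assms by (intro prob_space_gauss_measure)
  interpret B: sigma_finite_measure "block_lborel n" by (rule sigma_finite_block_lborel)
  have "(\<integral>\<^sup>+ z. F z \<partial>noise_pair n p q) =
      (\<integral>\<^sup>+ x. \<integral>\<^sup>+ y. F (x, y) \<partial>gauss_measure n q \<partial>gauss_measure n p)"
    using measurable_noise_pair[OF F] by (rule Q.nn_integral_fst[symmetric])
  also have "\<dots> = (\<integral>\<^sup>+ x. \<integral>\<^sup>+ y. ennreal (gauss n q y) * F (x, y) \<partial>block_lborel n \<partial>gauss_measure n p)"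
    by (intro nn_integral_cong nn_integral_gauss_measure)
      (use measurable_compose_Pair1[OF _ F] in \<open>simp add: space_gauss_measure\<close>)
  also have "\<dots> = (\<integral>\<^sup>+ x. ennreal (gauss n p x) *
      (\<integral>\<^sup>+ y. ennreal (gauss n q y) * F (x, y) \<partial>block_lborel n) \<partial>block_lborel n)"
  proof (rule nn_integral_gauss_measure)
    have "(\<lambda>z. ennreal (gauss n q (snd z)) * F (fst z, snd z))
        \<in> borel_measurable (block_lborel n \<Otimes>\<^sub>M block_lborel n)"
      using F by (intro borel_measurable_times_ennreal measurable_compose[OF gauss_measurable measurable_ennreal]
          snd_component_measurable) simp_all
    from B.borel_measurable_nn_integral_fst[OF this]
    show "(\<lambda>x. \<integral>\<^sup>+ y. ennreal (gauss n q y) * F (x, y) \<partial>block_lborel n)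
        \<in> borel_measurable (block_lborel n)"
      by simp
  qed
  also have "\<dots> = (\<integral>\<^sup>+ x. \<integral>\<^sup>+ y. ennreal (gauss n p x * gauss n q y) * F (x, y)
      \<partial>block_lborel n \<partial>block_lborel n)"
  proof (intro nn_integral_cong)
    fix x assume x: "x \<in> space (block_lborel n)"
    have "(\<lambda>y. ennreal (gauss n q y) * F (x, y)) \<in> borel_measurable (block_lborel n)"
      using measurable_compose_Pair1[OF x F]
      by (intro borel_measurable_times_ennreal measurable_compose[OF gauss_measurable measurable_ennreal]
          block_component_measurable) simp_all
    then show "ennreal (gauss n p x) * (\<integral>\<^sup>+ y. ennreal (gauss n q y) * F (x, y) \<partial>block_lborel n) =
        (\<integral>\<^sup>+ y. ennreal (gauss n p x * gauss n q y) * F (x, y) \<partial>block_lborel n)"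
      by (simp add: nn_integral_cmult[symmetric] ennreal_mult gauss_nonneg mult.assoc)
  qed
  finally show ?thesis .
qed

lemma nn_integral_block_swap:
  assumes "(\<lambda>z. F (fst z) (snd z)) \<in> borel_measurable (block_lborel n \<Otimes>\<^sub>M block_lborel n)"
  shows "(\<integral>\<^sup>+ x. \<integral>\<^sup>+ y. F x y \<partial>block_lborel n \<partial>block_lborel n) =
    (\<integral>\<^sup>+ y. \<integral>\<^sup>+ x. F x y \<partial>block_lborel n \<partial>block_lborel n)"
proof -
  interpret pair_sigma_finite "block_lborel n" "block_lborel n"
    by (intro pair_sigma_finite.intro sigma_finite_block_lborel)
  show ?thesis using Fubini[OF assms] by simp
qed

text \<open>After translating the second noise so that the integration variable is the sum, the
  joint density is rewritten by \<open>gauss_conditioning\<close>; the conditional density of the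
  first noise then integrates to 1 and leaves the marginal of the sum.\<close>

lemma distr_noise_pair_sum:
  fixes p q l :: real and n :: nat
  assumes "0 < p" "0 < q"
  defines "T \<equiv> \<lambda>z. restrict (\<lambda>t. l * fst z t + snd z t) {..<n}"
  shows "distr (noise_pair n p q) (block_lborel n) T = gauss_measure n (q + l\<^sup>2 * p)"
    and "T \<in> noise_pair n p q \<rightarrow>\<^sub>M block_lborel n"
proof -
  let ?B = "block_lborel n"
  define r where "r = q + l\<^sup>2 * p"
  have r: "0 < r" using assms by (simp add: r_def add_pos_nonneg)
  have T: "T \<in> ?B \<Otimes>\<^sub>M ?B \<rightarrow>\<^sub>M ?B"
    unfolding T_def by (intro measurable_block_restrict borel_measurable_add borel_measurable_times
        borel_measurable_const fst_component_measurable snd_component_measurable)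
  then show T': "T \<in> noise_pair n p q \<rightarrow>\<^sub>M ?B"
    using measurable_cong_sets[OF sets_noise_pair refl] by blast
  show "distr (noise_pair n p q) ?B T = gauss_measure n (q + l\<^sup>2 * p)"
  proof (rule measure_eqI)
    fix E assume "E \<in> sets (distr (noise_pair n p q) ?B T)"
    then have E: "E \<in> sets ?B" by simp
    \<comment> \<open>The restriction makes the indicator blind to coordinates outside
      \<open>{..<n}\<close>, as translation requires.\<close>
    define I where "I y = (indicator E (restrict y {..<n}) :: ennreal)" for y
    have Iinv: "I (restrict x {..<n}) = I x" for x
      by (simp add: I_def)
    have I: "I \<in> borel_measurable ?B"
      unfolding I_def by (rule measurable_compose[OF measurable_block_restrict
          borel_measurable_indicator[OF E]]) (rule block_component_measurable)
    have "emeasure (distr (noise_pair n p q) ?B T) E =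
        (\<integral>\<^sup>+ y. indicator E y \<partial>distr (noise_pair n p q) ?B T)"
      using E by simp
    also have "\<dots> = (\<integral>\<^sup>+ z. I (\<lambda>t. l * fst z t + snd z t) \<partial>noise_pair n p q)"
      using E T' by (subst nn_integral_distr) (auto simp: I_def T_def)
    also have "\<dots> = (\<integral>\<^sup>+ w. \<integral>\<^sup>+ y. ennreal (gauss n p w * gauss n q y) * I (\<lambda>t. l * w t + y t) \<partial>?B \<partial>?B)"
    proof (subst nn_integral_noise_pair)
      show "(\<lambda>z. I (\<lambda>t. l * fst z t + snd z t)) \<in> borel_measurable (?B \<Otimes>\<^sub>M ?B)"
        using measurable_compose[OF T I] by (simp add: T_def Iinv)
    qed (use assms in simp_all)
    also have "\<dots> = (\<integral>\<^sup>+ w. \<integral>\<^sup>+ y. ennreal (gauss n p w * gauss n q (\<lambda>t. y t - l * w t)) * I y \<partial>?B \<partial>?B)"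
    proof (rule nn_integral_cong)
      fix w assume "w \<in> space ?B"
      let ?F = "\<lambda>y. ennreal (gauss n p w * gauss n q (\<lambda>t. y t - l * w t)) * I y"
      have "(\<integral>\<^sup>+ y. ?F (\<lambda>t. l * w t + y t) \<partial>?B) = (\<integral>\<^sup>+ y. ?F y \<partial>?B)"
      proof (rule nn_integral_block_translate)
        show "?F \<in> borel_measurable ?B"
          by (intro borel_measurable_times_ennreal borel_measurable_times I measurable_compose[OF _ measurable_ennreal]
              gauss_measurable borel_measurable_diff block_component_measurable borel_measurable_const)
        show "?F (restrict x {..<n}) = ?F x" for x
          by (simp add: Iinv cong: gauss_cong)
      qed
      then show "(\<integral>\<^sup>+ y. ennreal (gauss n p w * gauss n q y) * I (\<lambda>t. l * w t + y t) \<partial>?B) =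
          (\<integral>\<^sup>+ y. ?F y \<partial>?B)" by simp
    qed
    also have "\<dots> = (\<integral>\<^sup>+ w. \<integral>\<^sup>+ y. ennreal (gauss n r y * gauss n (p * q / r) (\<lambda>t. w t - l * p / r * y t)) * I y \<partial>?B \<partial>?B)"
      unfolding r_def
      by (intro nn_integral_cong arg_cong2[where f="(*)", OF _ refl]
          arg_cong[where f=ennreal, OF gauss_conditioning[OF assms(1,2)]])
    also have "\<dots> = (\<integral>\<^sup>+ y. \<integral>\<^sup>+ w. ennreal (gauss n r y * gauss n (p * q / r) (\<lambda>t. w t - l * p / r * y t)) * I y \<partial>?B \<partial>?B)"
      by (rule nn_integral_block_swap)
        (intro borel_measurable_times_ennreal borel_measurable_times measurable_compose[OF _ measurable_ennreal]
           gauss_measurable borel_measurable_diff fst_component_measurable snd_component_measurable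
           borel_measurable_const measurable_compose[OF measurable_snd I])
    also have "\<dots> = (\<integral>\<^sup>+ y. ennreal (gauss n r y) * I y \<partial>?B)"
    proof (intro nn_integral_cong)
      fix y :: "nat \<Rightarrow> real"
      let ?G = "\<lambda>w. ennreal (gauss n (p * q / r) w)"
      let ?c = "\<lambda>t. - (l * p / r * y t)"
      have m: "(\<lambda>w. gauss n (p * q / r) (\<lambda>t. w t - l * p / r * y t)) \<in> borel_measurable ?B"
        by (intro gauss_measurable borel_measurable_diff block_component_measurable borel_measurable_const)
      have "(\<integral>\<^sup>+ w. ?G (\<lambda>t. ?c t + w t) \<partial>?B) = (\<integral>\<^sup>+ w. ?G w \<partial>?B)"
        by (rule nn_integral_block_translate)
          (auto intro!: measurable_compose[OF _ measurable_ennreal]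
              gauss_measurable block_component_measurable cong: gauss_cong)
      also have "\<dots> = 1" using assms r by (intro nn_integral_gauss) simp
      finally have 1: "(\<integral>\<^sup>+ w. ennreal (gauss n (p * q / r) (\<lambda>t. w t - l * p / r * y t)) \<partial>?B) = 1"
        by simp
      have "(\<integral>\<^sup>+ w. ennreal (gauss n r y * gauss n (p * q / r) (\<lambda>t. w t - l * p / r * y t)) * I y \<partial>?B) =
          (\<integral>\<^sup>+ w. ennreal (gauss n r y) * I y * ennreal (gauss n (p * q / r) (\<lambda>t. w t - l * p / r * y t)) \<partial>?B)"
        by (intro nn_integral_cong) (simp only: ennreal_mult[OF gauss_nonneg gauss_nonneg] mult_ac)
      also have "\<dots> = ennreal (gauss n r y) * I y"
        by (simp only: nn_integral_cmult[OF measurable_compose[OF m measurable_ennreal]] 1 mult_1_right)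
      finally show "(\<integral>\<^sup>+ w. ennreal (gauss n r y * gauss n (p * q / r) (\<lambda>t. w t - l * p / r * y t)) * I y \<partial>?B) =
          ennreal (gauss n r y) * I y" .
    qed
    also have "\<dots> = (\<integral>\<^sup>+ y. I y \<partial>gauss_measure n r)"
      using I by (rule nn_integral_gauss_measure[symmetric])
    also have "\<dots> = (\<integral>\<^sup>+ y. indicator E y \<partial>gauss_measure n r)"
      by (intro nn_integral_cong)
        (auto simp: I_def space_gauss_measure space_block_lborel PiE_restrict)
    also have "\<dots> = emeasure (gauss_measure n r) E"
      using E by (simp add: sets_gauss_measure)
    finally show "emeasure (distr (noise_pair n p q) ?B T) E = emeasure (gauss_measure n (q + l\<^sup>2 * p)) E"
      by (simp add: r_def)
  qed (simp add: sets_gauss_measure)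
qed

section \<open>Expectations of functions of one noise, of their sum, and of squares of affine
  forms\<close>

lemma noise_pair_fst:
  assumes "0 < q" and f: "integrable (gauss_measure n p) f"
  shows "integrable (noise_pair n p q) (\<lambda>z. f (fst z))"
    and "(\<integral>z. f (fst z) \<partial>noise_pair n p q) = (\<integral>x. f x \<partial>gauss_measure n p :: real)"
proof -
  interpret Q: prob_space "gauss_measure n q" using assms by (intro prob_space_gauss_measure)
  have d: "distr (noise_pair n p q) (gauss_measure n p) fst = gauss_measure n p"
    by (rule Q.distr_pair_fst)
  show "integrable (noise_pair n p q) (\<lambda>z. f (fst z))"
    using integrable_distr[OF measurable_fst, of "gauss_measure n p" "gauss_measure n q" f] f by (simp add: d)
  show "(\<integral>z. f (fst z) \<partial>noise_pair n p q) = (\<integral>x. f x \<partial>gauss_measure n p)"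
    using integral_distr[OF measurable_fst, of f "gauss_measure n p" "gauss_measure n q"] f
    by (simp add: d)
qed

lemma noise_pair_snd:
  assumes "0 < p" "0 < q" and f: "integrable (gauss_measure n q) f"
  shows "integrable (noise_pair n p q) (\<lambda>z. f (snd z))"
    and "(\<integral>z. f (snd z) \<partial>noise_pair n p q) = (\<integral>x. f x \<partial>gauss_measure n q :: real)"
proof -
  interpret P: prob_space "gauss_measure n p" using assms by (intro prob_space_gauss_measure)
  interpret Q: prob_space "gauss_measure n q" using assms by (intro prob_space_gauss_measure)
  interpret PQ: pair_prob_space "gauss_measure n p" "gauss_measure n q" ..
  have d: "distr (noise_pair n p q) (gauss_measure n q) snd = gauss_measure n q"
  proof (rule measure_eqI)
    fix E assume "E \<in> sets (distr (noise_pair n p q) (gauss_measure n q) snd)"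
    then have E: "E \<in> sets (gauss_measure n q)" by simp
    have "snd -` E \<inter> space (noise_pair n p q) = space (gauss_measure n p) \<times> E"
      using sets.sets_into_space[OF E] by (auto simp: space_pair_measure)
    then show "emeasure (distr (noise_pair n p q) (gauss_measure n q) snd) E = emeasure (gauss_measure n q) E"
      using E by (simp add: emeasure_distr Q.emeasure_pair_measure_Times P.emeasure_space_1)
  qed simp
  show "integrable (noise_pair n p q) (\<lambda>z. f (snd z))"
    using integrable_distr[OF measurable_snd, of "gauss_measure n p" "gauss_measure n q" f] f by (simp add: d)
  show "(\<integral>z. f (snd z) \<partial>noise_pair n p q) = (\<integral>x. f x \<partial>gauss_measure n q)"
    using integral_distr[OF measurable_snd, of f "gauss_measure n q" "gauss_measure n p"] f
    by (simp add: d)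
qed

lemma noise_pair_sum:
  fixes p q l :: real
  assumes "0 < p" "0 < q" and f: "integrable (gauss_measure n (q + l\<^sup>2 * p)) f"
    and inv: "\<And>x. f (restrict x {..<n}) = f x"
  shows "integrable (noise_pair n p q) (\<lambda>z. f (\<lambda>t. l * fst z t + snd z t))"
    and "(\<integral>z. f (\<lambda>t. l * fst z t + snd z t) \<partial>noise_pair n p q) =
      (\<integral>x. f x \<partial>gauss_measure n (q + l\<^sup>2 * p) :: real)"
proof -
  note d = distr_noise_pair_sum[OF assms(1,2), where l = l and n = n]
  have m: "f \<in> borel_measurable (block_lborel n)"
    using f by (auto simp: gauss_measure_def dest: borel_measurable_integrable)
  show "integrable (noise_pair n p q) (\<lambda>z. f (\<lambda>t. l * fst z t + snd z t))"
    using integrable_distr[OF d(2), of f] f by (simp add: d(1) inv)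
  show "(\<integral>z. f (\<lambda>t. l * fst z t + snd z t) \<partial>noise_pair n p q) =
      (\<integral>x. f x \<partial>gauss_measure n (q + l\<^sup>2 * p))"
    using integral_distr[OF d(2) m] by (simp add: d(1) inv)
qed

text \<open>The codewords enter as the deterministic offset \<open>e\<close>. Integrating out one
  noise at a time applies the one-variable formula twice, so the vanishing cross term never
  appears.\<close>

lemma noise_pair_second_moment:
  assumes "0 < p" "0 < q"
  shows "integrable (noise_pair n p q) (\<lambda>z. \<Sum>t<n. (e t + \<alpha> * fst z t + \<beta> * snd z t)\<^sup>2)"
    and "(\<integral>z. (\<Sum>t<n. (e t + \<alpha> * fst z t + \<beta> * snd z t)\<^sup>2) \<partial>noise_pair n p q) =
      (\<Sum>t<n. (e t)\<^sup>2) + n * (\<alpha>\<^sup>2 * p + \<beta>\<^sup>2 * q)"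
proof -
  interpret P: prob_space "gauss_measure n p" using assms by (intro prob_space_gauss_measure)
  interpret Q: prob_space "gauss_measure n q" using assms by (intro prob_space_gauss_measure)
  interpret PQ: pair_prob_space "gauss_measure n p" "gauss_measure n q" ..
  note mp = gauss_measure_second_moment[OF assms(1), of _ n]
    and mq = gauss_measure_second_moment[OF assms(2), of _ n]
  have t: "integrable (noise_pair n p q) (\<lambda>z. (e t + \<alpha> * fst z t + \<beta> * snd z t)\<^sup>2) \<and>
      (\<integral>z. (e t + \<alpha> * fst z t + \<beta> * snd z t)\<^sup>2 \<partial>noise_pair n p q) =
      (e t)\<^sup>2 + (\<alpha>\<^sup>2 * p + \<beta>\<^sup>2 * q)" if "t < n" for t
  proof
    let ?f = "\<lambda>z. (e t + \<alpha> * fst z t + \<beta> * snd z t)\<^sup>2"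
    show i: "integrable (noise_pair n p q) ?f"
    proof (rule PQ.Fubini_integrable)
      show "?f \<in> borel_measurable (noise_pair n p q)"
        using that by (intro measurable_noise_pair borel_measurable_power borel_measurable_add
            borel_measurable_times borel_measurable_const fst_component_measurable snd_component_measurable)
      show "AE x in gauss_measure n p. integrable (gauss_measure n q) (\<lambda>y. ?f (x, y))"
        using mq(1)[OF that] by simp
      show "integrable (gauss_measure n p) (\<lambda>x. \<integral>y. norm (?f (x, y)) \<partial>gauss_measure n q)"
        using mq(2)[OF that] mp(1)[OF that] by simp
    qed
    have "(\<integral>z. ?f z \<partial>noise_pair n p q) = (\<integral>x. (\<integral>y. ?f (x, y) \<partial>gauss_measure n q) \<partial>gauss_measure n p)"
      using PQ.integral_fst'[OF i] by simp
    also have "\<dots> = (\<integral>x. (e t + \<alpha> * x t)\<^sup>2 + \<beta>\<^sup>2 * q \<partial>gauss_measure n p)"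
      using mq(2)[OF that] by simp
    also have "\<dots> = (e t)\<^sup>2 + (\<alpha>\<^sup>2 * p + \<beta>\<^sup>2 * q)"
      using mp[OF that] by (simp add: P.prob_space)
    finally show "(\<integral>z. ?f z \<partial>noise_pair n p q) = (e t)\<^sup>2 + (\<alpha>\<^sup>2 * p + \<beta>\<^sup>2 * q)" .
  qed
  then show "integrable (noise_pair n p q) (\<lambda>z. \<Sum>t<n. (e t + \<alpha> * fst z t + \<beta> * snd z t)\<^sup>2)"
    by (intro Bochner_Integration.integrable_sum) auto
  show "(\<integral>z. (\<Sum>t<n. (e t + \<alpha> * fst z t + \<beta> * snd z t)\<^sup>2) \<partial>noise_pair n p q) =
      (\<Sum>t<n. (e t)\<^sup>2) + n * (\<alpha>\<^sup>2 * p + \<beta>\<^sup>2 * q)"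
    using t by (subst Bochner_Integration.integral_sum) (auto simp: sum.distrib algebra_simps)
qed

section \<open>Entropy of Gaussian mixtures\<close>

lemma gauss_measure_ln_gauss:
  assumes "0 < v"
  shows "integrable (gauss_measure n v) (\<lambda>x. ln (gauss n v x))"
    and "(\<integral>x. ln (gauss n v x) \<partial>gauss_measure n v) = - (real n / 2 * (ln (2 * pi * v) + 1))"
proof -
  interpret prob_space "gauss_measure n v" using assms by (intro prob_space_gauss_measure)
  have t: "integrable (gauss_measure n v) (\<lambda>x. (x t)\<^sup>2)"
      "(\<integral>x. (x t)\<^sup>2 \<partial>gauss_measure n v) = v" if "t < n" for t
    using gauss_measure_second_moment[OF assms that, of 0 1] by simp_all
  then have s: "integrable (gauss_measure n v) (\<lambda>x. \<Sum>t<n. (x t)\<^sup>2)"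
    by (intro Bochner_Integration.integrable_sum) auto
  then show "integrable (gauss_measure n v) (\<lambda>x. ln (gauss n v x))"
    using assms by (simp add: ln_gauss)
  have "(\<integral>x. (\<Sum>t<n. (x t)\<^sup>2) \<partial>gauss_measure n v) = n * v"
    using t by (subst Bochner_Integration.integral_sum) auto
  then show "(\<integral>x. ln (gauss n v x) \<partial>gauss_measure n v) = - (real n / 2 * (ln (2 * pi * v) + 1))"
    using assms s by (simp add: ln_gauss prob_space field_simps)
qed

lemma noise_pair_ln_gauss:
  fixes n :: nat and e :: "nat \<Rightarrow> real" and \<alpha> \<beta> :: real
  assumes "0 < p" "0 < q" "0 < v"
  defines "f \<equiv> \<lambda>z. ln (gauss n v (\<lambda>t. e t + \<alpha> * fst z t + \<beta> * snd z t))"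
  shows "integrable (noise_pair n p q) f"
    and "(\<integral>z. f z \<partial>noise_pair n p q) =
      - (real n / 2 * ln (2 * pi * v)) - ((\<Sum>t<n. (e t)\<^sup>2) + n * (\<alpha>\<^sup>2 * p + \<beta>\<^sup>2 * q)) / (2 * v)"
proof -
  interpret prob_space "noise_pair n p q" using assms by (intro prob_space_noise_pair)
  note m = noise_pair_second_moment[OF assms(1,2), of n e \<alpha> \<beta>]
  show "integrable (noise_pair n p q) f"
    unfolding f_def ln_gauss[OF assms(3)] using m(1) by simp
  show "(\<integral>z. f z \<partial>noise_pair n p q) =
      - (real n / 2 * ln (2 * pi * v)) - ((\<Sum>t<n. (e t)\<^sup>2) + n * (\<alpha>\<^sup>2 * p + \<beta>\<^sup>2 * q)) / (2 * v)"
    unfolding f_def ln_gauss[OF assms(3)] using m by (simp add: prob_space)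
qed

text \<open>The mixture lies between two controllable quantities: keeping only the summand of the
  codeword actually sent gives \<open>gauss n v x / card A\<close> from below, and the peak value of
  the Gaussian bounds it from above.\<close>

lemma integrable_ln_mixture:
  assumes "0 < v" "finite A" "a \<in> A"
  shows "integrable (gauss_measure n v) (\<lambda>x. ln (mixture n v A k (\<lambda>t. k a t + x t)))"
proof (rule Bochner_Integration.integrable_bound)
  interpret prob_space "gauss_measure n v" using assms by (intro prob_space_gauss_measure)
  let ?C = "real n / 2 * ln (2 * pi * v)"
  let ?b = "\<lambda>x. \<bar>ln (gauss n v x)\<bar> + (ln (card A) + \<bar>?C\<bar>)"
  show "integrable (gauss_measure n v) ?b"
    using gauss_measure_ln_gauss(1)[OF assms(1), of n] by (intro Bochner_Integration.integrable_add) auto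
  show "(\<lambda>x. ln (mixture n v A k (\<lambda>t. k a t + x t))) \<in> borel_measurable (gauss_measure n v)"
    by (intro borel_measurable_ln mixture_measurable borel_measurable_add borel_measurable_const)
      (simp add: gauss_measure_def block_component_measurable)
  have c: "0 < card A" using assms by (auto simp: card_gt_0_iff)
  have "norm (ln (mixture n v A k (\<lambda>t. k a t + x t))) \<le> norm (?b x)" for x
  proof -
    let ?m = "mixture n v A k (\<lambda>t. k a t + x t)"
    have "0 < ?m" using assms by (intro mixture_pos) auto
    have "gauss n v (\<lambda>t. k a t + x t - k a t) \<le> (\<Sum>a'\<in>A. gauss n v (\<lambda>t. k a t + x t - k a' t))"
      using assms by (intro member_le_sum) (auto simp: gauss_nonneg)
    then have "gauss n v x / card A \<le> ?m"
      unfolding mixture_def by (intro divide_right_mono) auto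
    then have "ln (gauss n v x / card A) \<le> ln ?m"
      using gauss_pos[OF assms(1)] c by (intro ln_mono) auto
    then have lo: "ln (gauss n v x) - ln (card A) \<le> ln ?m"
      using gauss_pos[OF assms(1), of n x] c by (simp add: ln_div)
    have "(\<Sum>a'\<in>A. gauss n v (\<lambda>t. k a t + x t - k a' t)) \<le> card A * exp (- ?C)"
      using assms by (intro sum_bounded_above gauss_le)
    then have "?m \<le> exp (- ?C)"
      using c by (simp add: mixture_def field_simps)
    then have hi: "ln ?m \<le> - ?C"
      using \<open>0 < ?m\<close> by (metis ln_exp ln_mono)
    have "0 \<le> ln (real (card A))" using c by simp
    then show ?thesis using lo hi by (simp add: abs_if split: if_splits)
  qed
  then show "AE x in gauss_measure n v. norm (ln (mixture n v A k (\<lambda>t. k a t + x t))) \<le> norm (?b x)"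
    by simp
qed

lemma nn_integral_gauss_shift:
  assumes "0 < v"
  shows "(\<integral>\<^sup>+ x. ennreal (gauss n v (\<lambda>t. x t - e t)) \<partial>block_lborel n) = 1"
proof -
  have "(\<integral>\<^sup>+ x. ennreal (gauss n v (\<lambda>t. - e t + x t)) \<partial>block_lborel n) =
      (\<integral>\<^sup>+ x. ennreal (gauss n v x) \<partial>block_lborel n)"
    by (rule nn_integral_block_translate)
      (auto intro!: measurable_compose[OF _ measurable_ennreal]
            gauss_measurable block_component_measurable cong: gauss_cong)
  then show ?thesis using assms by (simp add: nn_integral_gauss)
qed

lemma nn_integral_mixture:
  assumes "0 < v" "finite A" "A \<noteq> {}"
  shows "(\<integral>\<^sup>+ x. ennreal (mixture n v A k x) \<partial>block_lborel n) = 1"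
proof -
  note 1 = nn_integral_gauss_shift[OF assms(1)]
  have m: "(\<lambda>x. gauss n v (\<lambda>t. x t - k a t)) \<in> borel_measurable (block_lborel n)" for a
    by (intro gauss_measurable borel_measurable_diff block_component_measurable borel_measurable_const)
  have c: "0 < card A" using assms by (auto simp: card_gt_0_iff)
  have "(\<integral>\<^sup>+ x. ennreal (mixture n v A k x) \<partial>block_lborel n) =
      (\<integral>\<^sup>+ x. (\<Sum>a\<in>A. ennreal (gauss n v (\<lambda>t. x t - k a t))) / ennreal (card A) \<partial>block_lborel n)"
    unfolding mixture_def using c
    by (simp add: divide_ennreal sum_nonneg gauss_nonneg)
  also have "\<dots> = (\<integral>\<^sup>+ x. (\<Sum>a\<in>A. ennreal (gauss n v (\<lambda>t. x t - k a t))) \<partial>block_lborel n) / ennreal (card A)"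
    using m by (subst nn_integral_divide) auto
  also have "\<dots> = ennreal (card A) / ennreal (card A)"
    using m by (subst nn_integral_sum) (auto simp: 1 ennreal_of_nat_eq_real_of_nat)
  finally show ?thesis using c by (simp add: divide_ennreal)
qed

text \<open>Integrate \<open>1 + f \<le> exp f\<close>. With \<open>f\<close> the logarithm of a
  ratio of test to true density and \<open>X\<close> the message set, this says that relative
  entropy is nonnegative. Stating the bound on the exponentials with nonnegative integrals makes
  their integrability a consequence; for infinite \<open>X\<close> the sum in the conclusion is 0 by
  convention.\<close>

lemma gibbs_inequality:
  assumes "prob_space M" and "\<And>i. i \<in> X \<Longrightarrow> integrable M (f i)"
    and "(\<Sum>i\<in>X. \<integral>\<^sup>+ \<omega>. ennreal (exp (f i \<omega>)) \<partial>M) \<le> ennreal (card X)"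
  shows "(\<Sum>i\<in>X. \<integral>\<omega>. f i \<omega> \<partial>M) \<le> 0"
proof (cases "finite X")
  case True
  interpret prob_space M by fact
  have i: "integrable M (\<lambda>\<omega>. exp (f i \<omega>))" if "i \<in> X" for i
  proof (rule integrableI_nonneg)
    show "(\<lambda>\<omega>. exp (f i \<omega>)) \<in> borel_measurable M"
      using assms(2)[OF that] by measurable
    have "(\<integral>\<^sup>+ \<omega>. ennreal (exp (f i \<omega>)) \<partial>M) \<le> (\<Sum>i\<in>X. \<integral>\<^sup>+ \<omega>. ennreal (exp (f i \<omega>)) \<partial>M)"
      using that True by (intro member_le_sum) auto
    then show "(\<integral>\<^sup>+ \<omega>. ennreal (exp (f i \<omega>)) \<partial>M) < \<infinity>"
      using assms(3) by (metis ennreal_less_top infinity_ennreal_def order.strict_trans1 order_trans)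
  qed simp
  have "(\<Sum>i\<in>X. \<integral>\<omega>. 1 + f i \<omega> \<partial>M) \<le> (\<Sum>i\<in>X. \<integral>\<omega>. exp (f i \<omega>) \<partial>M)"
    using assms(2) i by (intro sum_mono integral_mono) (auto intro: exp_ge_add_one_self)
  moreover have "(\<Sum>i\<in>X. \<integral>\<omega>. exp (f i \<omega>) \<partial>M) \<le> card X"
  proof -
    have "ennreal (\<Sum>i\<in>X. \<integral>\<omega>. exp (f i \<omega>) \<partial>M) = (\<Sum>i\<in>X. \<integral>\<^sup>+ \<omega>. ennreal (exp (f i \<omega>)) \<partial>M)"
      using i by (simp add: nn_integral_eq_integral)
    with assms(3) show ?thesis by (metis ennreal_le_iff of_nat_0_le_iff)
  qed
  moreover have "(\<Sum>i\<in>X. \<integral>\<omega>. 1 + f i \<omega> \<partial>M) = card X + (\<Sum>i\<in>X. \<integral>\<omega>. f i \<omega> \<partial>M)"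
    using assms(2) by (simp add: prob_space sum.distrib)
  ultimately show ?thesis by simp
qed simp

text \<open>Differential entropy, in nats, of a uniform codeword plus noise. Conditioning on the
  codeword expresses it through integrals against the centred noise law only.\<close>

definition mixture_entropy :: "nat \<Rightarrow> real \<Rightarrow> 'a set \<Rightarrow> ('a \<Rightarrow> nat \<Rightarrow> real) \<Rightarrow> real" where
  "mixture_entropy n v A k =
     - (\<Sum>a\<in>A. \<integral>x. ln (mixture n v A k (\<lambda>t. k a t + x t)) \<partial>gauss_measure n v) / card A"

text \<open>Each quotient is \<open>card A\<close> times the posterior probability of
  \<open>a\<close> given x, and posterior probabilities sum to 1.\<close>

lemma sum_gauss_div_mixture:
  assumes "0 < v" "finite A" "A \<noteq> {}"
  shows "(\<Sum>a\<in>A. gauss n v (\<lambda>t. x t - k a t) / mixture n v A k x) = card A"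
proof -
  have "0 < mixture n v A k x" "0 < card A"
    using assms by (auto intro: mixture_pos simp: card_gt_0_iff)
  then show ?thesis
    unfolding sum_divide_distrib[symmetric] by (simp add: mixture_def zero_less_divide_iff)
qed

text \<open>Total mass of the test law used in both entropy inequalities: s follows the mixture and,
  given s, y is Gaussian about its linear estimate \<open>c * s\<close>.\<close>

lemma nn_integral_mixture_gauss:
  assumes "0 < v" "0 < r" "finite A" "A \<noteq> {}"
  shows "(\<integral>\<^sup>+ s. \<integral>\<^sup>+ y. ennreal (mixture n v A k s * gauss n r (\<lambda>t. y t - c * s t))
    \<partial>block_lborel n \<partial>block_lborel n) = 1"
proof -
  have "(\<integral>\<^sup>+ y. ennreal (mixture n v A k s * gauss n r (\<lambda>t. y t - c * s t)) \<partial>block_lborel n) =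
      ennreal (mixture n v A k s)" for s
  proof -
    have m: "(\<lambda>y. gauss n r (\<lambda>t. y t - c * s t)) \<in> borel_measurable (block_lborel n)"
      by (intro gauss_measurable borel_measurable_diff block_component_measurable borel_measurable_const)
    have "(\<integral>\<^sup>+ y. ennreal (mixture n v A k s * gauss n r (\<lambda>t. y t - c * s t)) \<partial>block_lborel n) =
        (\<integral>\<^sup>+ y. ennreal (mixture n v A k s) * ennreal (gauss n r (\<lambda>t. y t - c * s t)) \<partial>block_lborel n)"
      by (intro nn_integral_cong ennreal_mult mixture_nonneg gauss_nonneg)
    also have "\<dots> = ennreal (mixture n v A k s)"
      by (simp only: nn_integral_cmult[OF measurable_compose[OF m measurable_ennreal]]
          nn_integral_gauss_shift[OF assms(2)] mult_1_right)
    finally show ?thesis .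
  qed
  then show ?thesis using assms by (simp add: nn_integral_mixture)
qed

text \<open>
  Adding independent Gaussian noise \<open>N\<close> to \<open>S\<close> raises the entropy at least as much as it would for
  Gaussian \<open>S\<close>: with \<open>T = S + N\<close>, the increment is the mutual information between \<open>N\<close> and \<open>T\<close>,
  which is bounded below through the error of the linear estimator \<open>c T\<close> of \<open>N\<close>.
\<close>

lemma mixture_entropy_increment:
  fixes n :: nat and v :: "'a \<Rightarrow> nat \<Rightarrow> real" and I :: real
  assumes "0 < p" "0 < q" "finite A" "A \<noteq> {}" "0 \<le> I"
    and power: "(\<Sum>a\<in>A. \<Sum>t<n. (v a t)\<^sup>2) \<le> card A * (n * I)"
  shows "mixture_entropy n p A v - mixture_entropy n (p + q) A v
    \<le> n / 2 * ln ((I + p) / (I + (p + q)))"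
proof -
  let ?B = "block_lborel n"
  define r where "r = p + q"
  \<comment> \<open>For a codeword part of power I per coordinate, T has variance
    \<open>I + r\<close> and covariance q with the added noise. Thus c is the optimal linear
    coefficient for estimating that noise from T, and \<kappa> is the resulting error
    variance.\<close>
  define c where "c = q / (I + r)"
  define \<kappa> where "\<kappa> = q * (I + p) / (I + r)"
  have pos: "0 < r" "0 < I + r" "0 < I + p" "0 < \<kappa>" "0 < card A"
    using assms by (auto simp: r_def \<kappa>_def card_gt_0_iff intro!: divide_pos_pos mult_pos_pos)
  \<comment> \<open>Log-ratio of two laws: T with its true density and the added noise Gaussian
    about \<open>c * T\<close>, against the independent pair of S and the noise. The argument of the
    middle Gaussian is the noise minus \<open>c * T\<close>, written out.\<close>
  define f where "f a z = ln (mixture n r A v (\<lambda>t. v a t + (1 * fst z t + snd z t)))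
      + ln (gauss n \<kappa> (\<lambda>t. - c * v a t + (- c) * fst z t + (1 - c) * snd z t))
      - ln (mixture n p A v (\<lambda>t. v a t + fst z t)) - ln (gauss n q (snd z))" for a z
  note G = noise_pair_ln_gauss[OF assms(1,2) pos(4), of n _ "-c" "1 - c"]
  have S: "integrable (gauss_measure n (q + 1\<^sup>2 * p)) (\<lambda>x. ln (mixture n r A v (\<lambda>t. v a t + x t)))"
    if "a \<in> A" for a
    using integrable_ln_mixture[OF pos(1) assms(3) that, of n v] by (simp add: r_def add.commute)
  have inv: "ln (mixture n w A v (\<lambda>t. v a t + restrict x {..<n} t)) = ln (mixture n w A v (\<lambda>t. v a t + x t))"
    for a w x
    by (intro arg_cong[where f=ln] mixture_cong) simp
  note S = noise_pair_sum[OF assms(1,2) S inv]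
  note F = noise_pair_fst[OF assms(2) integrable_ln_mixture[OF assms(1,3)], of _ n v]
  note N = noise_pair_snd[OF assms(1,2) gauss_measure_ln_gauss(1)[OF assms(2)], of n]
  have int: "integrable (noise_pair n p q) (f a)" if "a \<in> A" for a
    unfolding f_def using S(1)[OF that] G(1) F(1)[OF that] N(1)
    by (intro Bochner_Integration.integrable_add Bochner_Integration.integrable_diff)
  have integral: "(\<integral>z. f a z \<partial>noise_pair n p q) =
      (\<integral>x. ln (mixture n r A v (\<lambda>t. v a t + x t)) \<partial>gauss_measure n r)
      + (- (real n / 2 * ln (2 * pi * \<kappa>))
         - (c\<^sup>2 * (\<Sum>t<n. (v a t)\<^sup>2) + n * (c\<^sup>2 * p + (1 - c)\<^sup>2 * q)) / (2 * \<kappa>))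
      - (\<integral>x. ln (mixture n p A v (\<lambda>t. v a t + x t)) \<partial>gauss_measure n p)
      + real n / 2 * (ln (2 * pi * q) + 1)" if "a \<in> A" for a
  proof -
    have "(\<integral>z. f a z \<partial>noise_pair n p q) =
      (\<integral>z. ln (mixture n r A v (\<lambda>t. v a t + (1 * fst z t + snd z t))) \<partial>noise_pair n p q)
      + (\<integral>z. ln (gauss n \<kappa> (\<lambda>t. - c * v a t + (- c) * fst z t + (1 - c) * snd z t)) \<partial>noise_pair n p q)
      - (\<integral>z. ln (mixture n p A v (\<lambda>t. v a t + fst z t)) \<partial>noise_pair n p q)
      - (\<integral>z. ln (gauss n q (snd z)) \<partial>noise_pair n p q)"
      unfolding f_def using S(1)[OF that] G(1) F(1)[OF that] N(1)
      by (simp only: Bochner_Integration.integral_add Bochner_Integration.integral_diff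
          Bochner_Integration.integrable_add Bochner_Integration.integrable_diff)
    also have "\<dots> = (\<integral>x. ln (mixture n r A v (\<lambda>t. v a t + x t)) \<partial>gauss_measure n (q + 1\<^sup>2 * p))
      + (- (real n / 2 * ln (2 * pi * \<kappa>))
         - ((\<Sum>t<n. (- c * v a t)\<^sup>2) + n * ((- c)\<^sup>2 * p + (1 - c)\<^sup>2 * q)) / (2 * \<kappa>))
      - (\<integral>x. ln (mixture n p A v (\<lambda>t. v a t + x t)) \<partial>gauss_measure n p)
      - (- (real n / 2 * (ln (2 * pi * q) + 1)))"
      by (simp only: S(2)[OF that] G(2) F(2)[OF that] N(2) gauss_measure_ln_gauss(2)[OF assms(2)])
    finally show ?thesis
      by (simp add: power_mult_distrib sum_distrib_left r_def add.commute)
  qed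
  have "(\<Sum>a\<in>A. \<integral>\<^sup>+ z. ennreal (exp (f a z)) \<partial>noise_pair n p q) \<le> ennreal (card A)"
  proof -
    \<comment> \<open>After translation by the codeword, s is the value of S and y the added noise;
      only the quotient in front of \<open>?K\<close> depends on \<open>a\<close>.\<close>
    let ?K = "\<lambda>s y. mixture n r A v (\<lambda>t. s t + y t) * gauss n \<kappa> (\<lambda>t. y t - c * (s t + y t))"
    let ?R = "\<lambda>a s y. gauss n p (\<lambda>t. s t - v a t) / mixture n p A v s * ?K s y"
    have Rm: "(\<lambda>s. ennreal (?R a s y)) \<in> borel_measurable ?B" for a y
      by (intro measurable_compose[OF _ measurable_ennreal] borel_measurable_times
          borel_measurable_divide gauss_measurable mixture_measurable borel_measurable_diff
          borel_measurable_add borel_measurable_const block_component_measurable)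
    have "(\<integral>\<^sup>+ z. ennreal (exp (f a z)) \<partial>noise_pair n p q) =
        (\<integral>\<^sup>+ y. \<integral>\<^sup>+ s. ennreal (?R a s y) \<partial>?B \<partial>?B)" if "a \<in> A" for a
    proof -
      have m: "(\<lambda>z. ennreal (exp (f a z))) \<in> borel_measurable (?B \<Otimes>\<^sub>M ?B)"
        unfolding f_def
        by (intro measurable_compose[OF _ measurable_ennreal] measurable_compose[OF _ borel_measurable_exp]
          borel_measurable_ln borel_measurable_times
          gauss_measurable mixture_measurable borel_measurable_diff
          borel_measurable_add borel_measurable_const fst_component_measurable snd_component_measurable)
      have "ennreal (gauss n p s * gauss n q y) * ennreal (exp (f a (s, y))) =
          ennreal (?R a (\<lambda>t. v a t + s t) y)" for s y
      proof -
        have "- c * v a t + (- c) * s t + (1 - c) * y t = y t - c * (v a t + s t + y t)" for t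
          by (simp add: algebra_simps)
        then have "exp (f a (s, y)) = ?K (\<lambda>t. v a t + s t) y / mixture n p A v (\<lambda>t. v a t + s t) / gauss n q y"
          unfolding f_def exp_diff exp_add fst_conv snd_conv using assms pos
          by (simp add: gauss_pos mixture_pos add.assoc)
        then show ?thesis
          using gauss_pos[OF assms(2), of n y]
          by (simp add: ennreal_mult[symmetric] gauss_nonneg mixture_nonneg)
      qed
      then have "(\<integral>\<^sup>+ z. ennreal (exp (f a z)) \<partial>noise_pair n p q) =
          (\<integral>\<^sup>+ s. \<integral>\<^sup>+ y. ennreal (?R a (\<lambda>t. v a t + s t) y) \<partial>?B \<partial>?B)"
        unfolding nn_integral_noise_pair[OF m assms(1,2)] by simp
      also have "\<dots> = (\<integral>\<^sup>+ y. \<integral>\<^sup>+ s. ennreal (?R a (\<lambda>t. v a t + s t) y) \<partial>?B \<partial>?B)"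
        by (intro nn_integral_block_swap measurable_compose[OF _ measurable_ennreal]
            borel_measurable_times borel_measurable_divide gauss_measurable mixture_measurable
            borel_measurable_diff borel_measurable_add borel_measurable_const
            fst_component_measurable snd_component_measurable)
      also have "\<dots> = (\<integral>\<^sup>+ y. \<integral>\<^sup>+ s. ennreal (?R a s y) \<partial>?B \<partial>?B)"
        by (intro nn_integral_cong nn_integral_block_translate[where F="\<lambda>s. ennreal (?R a s _)"] Rm)
          (simp cong: gauss_cong mixture_cong)
      finally show ?thesis .
    qed
    then have "(\<Sum>a\<in>A. \<integral>\<^sup>+ z. ennreal (exp (f a z)) \<partial>noise_pair n p q) =
        (\<Sum>a\<in>A. \<integral>\<^sup>+ y. \<integral>\<^sup>+ s. ennreal (?R a s y) \<partial>?B \<partial>?B)"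
      by simp
    also have "\<dots> = (\<integral>\<^sup>+ y. (\<Sum>a\<in>A. \<integral>\<^sup>+ s. ennreal (?R a s y) \<partial>?B) \<partial>?B)"
    proof (rule nn_integral_sum[symmetric])
      interpret B: sigma_finite_measure ?B by (rule sigma_finite_block_lborel)
      fix a
      have "(\<lambda>z. ennreal (?R a (snd z) (fst z))) \<in> borel_measurable (?B \<Otimes>\<^sub>M ?B)"
        by (intro measurable_compose[OF _ measurable_ennreal]
            borel_measurable_times borel_measurable_divide gauss_measurable mixture_measurable
            borel_measurable_diff borel_measurable_add borel_measurable_const
            fst_component_measurable snd_component_measurable)
      from B.borel_measurable_nn_integral_fst[OF this]
      show "(\<lambda>y. \<integral>\<^sup>+ s. ennreal (?R a s y) \<partial>?B) \<in> borel_measurable ?B" by simp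
    qed
    also have "\<dots> = (\<integral>\<^sup>+ y. \<integral>\<^sup>+ s. ennreal (card A) * ennreal (?K s y) \<partial>?B \<partial>?B)"
    proof (rule nn_integral_cong)
      fix y
      have "(\<Sum>a\<in>A. \<integral>\<^sup>+ s. ennreal (?R a s y) \<partial>?B) = (\<integral>\<^sup>+ s. (\<Sum>a\<in>A. ennreal (?R a s y)) \<partial>?B)"
        by (rule nn_integral_sum[symmetric]) (rule Rm)
      also have "\<dots> = (\<integral>\<^sup>+ s. ennreal (card A) * ennreal (?K s y) \<partial>?B)"
      proof (rule nn_integral_cong)
        fix s
        have "(\<Sum>a\<in>A. ennreal (?R a s y)) = ennreal (\<Sum>a\<in>A. ?R a s y)"
          by (intro sum_ennreal mult_nonneg_nonneg divide_nonneg_nonneg gauss_nonneg mixture_nonneg)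
        also have "(\<Sum>a\<in>A. ?R a s y) = card A * ?K s y"
          unfolding sum_distrib_right[symmetric] sum_gauss_div_mixture[OF assms(1,3,4)] ..
        also have "ennreal \<dots> = ennreal (card A) * ennreal (?K s y)"
          by (intro ennreal_mult mult_nonneg_nonneg gauss_nonneg mixture_nonneg) simp
        finally show "(\<Sum>a\<in>A. ennreal (?R a s y)) = ennreal (card A) * ennreal (?K s y)" .
      qed
      finally show "(\<Sum>a\<in>A. \<integral>\<^sup>+ s. ennreal (?R a s y) \<partial>?B) =
          (\<integral>\<^sup>+ s. ennreal (card A) * ennreal (?K s y) \<partial>?B)" .
    qed
    \<comment> \<open>Change of variable from S to \<open>T = y + S\<close>.\<close>
    also have "\<dots> = (\<integral>\<^sup>+ y. \<integral>\<^sup>+ s. ennreal (card A) *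
        ennreal (mixture n r A v s * gauss n \<kappa> (\<lambda>t. y t - c * s t)) \<partial>?B \<partial>?B)"
    proof (rule nn_integral_cong)
      fix y :: "nat \<Rightarrow> real"
      let ?F = "\<lambda>s. ennreal (card A) * ennreal (mixture n r A v s * gauss n \<kappa> (\<lambda>t. y t - c * s t))"
      have "(\<integral>\<^sup>+ s. ?F (\<lambda>t. y t + s t) \<partial>?B) = (\<integral>\<^sup>+ s. ?F s \<partial>?B)"
      proof (rule nn_integral_block_translate)
        show "?F \<in> borel_measurable ?B"
          by (intro borel_measurable_times_ennreal measurable_compose[OF _ measurable_ennreal]
              borel_measurable_times gauss_measurable mixture_measurable
              borel_measurable_diff borel_measurable_const block_component_measurable)
      qed (simp cong: gauss_cong mixture_cong)
      then show "(\<integral>\<^sup>+ s. ennreal (card A) * ennreal (?K s y) \<partial>?B) = (\<integral>\<^sup>+ s. ?F s \<partial>?B)"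
        by (simp add: add.commute)
    qed
    also have "\<dots> = (\<integral>\<^sup>+ s. \<integral>\<^sup>+ y. ennreal (card A) *
        ennreal (mixture n r A v s * gauss n \<kappa> (\<lambda>t. y t - c * s t)) \<partial>?B \<partial>?B)"
      by (intro nn_integral_block_swap borel_measurable_times_ennreal measurable_compose[OF _ measurable_ennreal]
              borel_measurable_times gauss_measurable mixture_measurable
              borel_measurable_diff borel_measurable_const
            fst_component_measurable snd_component_measurable)
    also have "\<dots> = ennreal (card A) * (\<integral>\<^sup>+ s. \<integral>\<^sup>+ y.
        ennreal (mixture n r A v s * gauss n \<kappa> (\<lambda>t. y t - c * s t)) \<partial>?B \<partial>?B)"
    proof -
      interpret B: sigma_finite_measure ?B by (rule sigma_finite_block_lborel)
      have "(\<lambda>z. ennreal (mixture n r A v (fst z) * gauss n \<kappa> (\<lambda>t. snd z t - c * fst z t)))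
          \<in> borel_measurable (?B \<Otimes>\<^sub>M ?B)"
        by (intro measurable_compose[OF _ measurable_ennreal]
            borel_measurable_times gauss_measurable mixture_measurable
            borel_measurable_diff borel_measurable_const
            fst_component_measurable snd_component_measurable)
      from B.borel_measurable_nn_integral_fst[OF this]
      show ?thesis
        by (subst nn_integral_cmult[symmetric])
          (auto intro!: nn_integral_cong nn_integral_cmult measurable_compose[OF _ measurable_ennreal]
            borel_measurable_times gauss_measurable mixture_measurable
            borel_measurable_diff borel_measurable_const block_component_measurable)
    qed
    also have "\<dots> = ennreal (card A)"
      using assms pos by (simp add: nn_integral_mixture_gauss)
    finally show ?thesis by simp
  qed
  then have "(\<Sum>a\<in>A. \<integral>z. f a z \<partial>noise_pair n p q) \<le> 0"
    using assms int by (intro gibbs_inequality prob_space_noise_pair)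
  moreover define Q where "Q = (c\<^sup>2 * (\<Sum>a\<in>A. \<Sum>t<n. (v a t)\<^sup>2)
      + card A * (n * (c\<^sup>2 * p + (1 - c)\<^sup>2 * q))) / (2 * \<kappa>)"
  have "(\<Sum>a\<in>A. \<integral>z. f a z \<partial>noise_pair n p q) =
      - (card A * mixture_entropy n r A v) + card A * mixture_entropy n p A v
      - card A * (real n / 2 * ln (2 * pi * \<kappa>))
      - Q + card A * (real n / 2 * (ln (2 * pi * q) + 1))"
    unfolding Q_def using pos(5) by (simp add: integral mixture_entropy_def sum.distrib sum_subtractf sum_negf
        sum_distrib_left[symmetric] sum_divide_distrib[symmetric] add_divide_distrib)
  moreover
  have "c\<^sup>2 * (\<Sum>a\<in>A. \<Sum>t<n. (v a t)\<^sup>2) + card A * (n * (c\<^sup>2 * p + (1 - c)\<^sup>2 * q))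
      \<le> card A * (n * \<kappa>)"
  proof -
    \<comment> \<open>The error variance at power exactly I. The left side increases with the power,
      so the upper bound \<open>power\<close> suffices.\<close>
    have "c\<^sup>2 * (I + p) + (1 - c)\<^sup>2 * q = \<kappa>"
    proof -
      have c': "1 - c = (I + p) / (I + r)"
        using pos by (simp add: c_def r_def field_simps)
      have "c\<^sup>2 * (I + p) + (1 - c)\<^sup>2 * q = (q\<^sup>2 * (I + p) + (I + p)\<^sup>2 * q) / (I + r)\<^sup>2"
        unfolding c' by (simp only: c_def power_divide) (simp add: add_divide_distrib)
      also have "q\<^sup>2 * (I + p) + (I + p)\<^sup>2 * q = q * (I + p) * (I + r)"
        by (simp add: r_def power2_eq_square algebra_simps)
      finally show ?thesis
        using pos by (simp add: \<kappa>_def power2_eq_square)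
    qed
    then have "card A * (n * \<kappa>) = c\<^sup>2 * (card A * (n * I)) + card A * (n * (c\<^sup>2 * p + (1 - c)\<^sup>2 * q))"
      by (simp add: algebra_simps flip: \<open>_ = \<kappa>\<close>)
    then show ?thesis
      using mult_left_mono[OF power, of "c\<^sup>2"] by simp
  qed
  \<comment> \<open>This \<open>n / 2\<close> per codeword cancels the \<open>+ 1\<close> in the
    Gaussian entropy of the added noise.\<close>
  then have "Q \<le> card A * (n / 2)"
    unfolding Q_def using pos(4) by (subst pos_divide_le_eq) (auto simp: mult.assoc)
  ultimately have "card A * (mixture_entropy n p A v - mixture_entropy n r A v)
      \<le> card A * (real n / 2 * (ln (2 * pi * \<kappa>) - ln (2 * pi * q)))"
    by (simp add: algebra_simps)
  then have "mixture_entropy n p A v - mixture_entropy n r A v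
      \<le> real n / 2 * (ln (2 * pi * \<kappa>) - ln (2 * pi * q))"
    using pos(5) by simp
  also have "ln (2 * pi * \<kappa>) - ln (2 * pi * q) = ln ((I + p) / (I + r))"
    using pos assms(2) by (simp add: \<kappa>_def ln_div ln_mult)
  finally show ?thesis by (simp add: r_def)
qed

section \<open>The genie-aided bound at one receiver\<close>

text \<open>
  One receiver with its genie: the own codeword pair is \<open>a\<close>, with useful part \<open>u a\<close> and part \<open>v a\<close>
  leaking to the other receiver; \<open>k b\<close> is the received interference. The genie provides
  \<open>S = v a + w\<close> and the received block is \<open>Y = u a + k b + l w + N\<close>. Fano's inequality is the part of
  the Gibbs inequality contributed by the test distribution of \<open>a\<close> given \<open>Y\<close> that puts mass \<open>1/2\<close>
  on the decoded value and spreads the other half uniformly; \<open>Y\<close> given \<open>S\<close> is tested against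
  a Gaussian centred at \<open>c S\<close>.
\<close>

lemma genie_bound:
  fixes n :: nat and u v :: "'a \<Rightarrow> nat \<Rightarrow> real" and k :: "'b \<Rightarrow> nat \<Rightarrow> real" and l c \<sigma> :: real
    and g :: "(nat \<Rightarrow> real) \<Rightarrow> 'a"
  assumes pq: "0 < p" "0 < q" "0 < \<sigma>" and A: "finite A" "A \<noteq> {}" and B: "finite B" "B \<noteq> {}"
    and g: "g \<in> block_lborel n \<rightarrow>\<^sub>M count_space UNIV"
  defines "err \<equiv> (\<Sum>(a, b)\<in>A \<times> B. measure (gauss_measure n (q + l\<^sup>2 * p))
      {z \<in> space (gauss_measure n (q + l\<^sup>2 * p)). g (restrict (\<lambda>t. u a t + k b t + z t) {..<n}) \<noteq> a})
      / (card A * card B)"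
    and "D \<equiv> (\<Sum>(a, b)\<in>A \<times> B. \<Sum>t<n. (u a t + k b t - c * v a t)\<^sup>2) / (card A * card B)"
  shows "(1 - err) * ln (card A) - ln 2 \<le>
      mixture_entropy n p A v - mixture_entropy n q B k
      + n / 2 * (ln (2 * pi * \<sigma>) - ln (2 * pi * p) - 1) + (D + n * ((l - c)\<^sup>2 * p + q)) / (2 * \<sigma>)"
proof -
  let ?B = "block_lborel n"
  define r where "r = q + l\<^sup>2 * p"
  have pos: "0 < r" "0 < card A" "0 < card B"
    using pq A B by (auto simp: r_def card_gt_0_iff add_pos_nonneg)
  \<comment> \<open>Logarithm of the test weight of \<open>a\<close>. The uniform share is dropped
    at the decoded value, so the weights sum to at most 1, whether or not \<open>g y\<close> lies in
    \<open>A\<close>.\<close>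
  define lq where "lq a y = (if g y = a then - ln 2 else - ln 2 - ln (card A))" for a y
  have lqm: "(\<lambda>x. lq a (restrict (y x) {..<n})) \<in> borel_measurable M"
    if "\<And>t. t < n \<Longrightarrow> (\<lambda>x. y x t) \<in> borel_measurable M" for a M and y :: "'z \<Rightarrow> nat \<Rightarrow> real"
    unfolding lq_def
    by (rule measurable_compose[OF measurable_compose[OF measurable_block_restrict g]]) (simp_all add: that)
  have lqm1: "(\<lambda>x. lq a (restrict (\<lambda>t. e t + x t) {..<n})) \<in> borel_measurable ?B" for a e
    by (intro lqm borel_measurable_add borel_measurable_const block_component_measurable)
  have lqsum: "(\<Sum>a\<in>A. exp (lq a y)) \<le> 1" for y
  proof -
    have "(\<Sum>a\<in>A. exp (lq a y)) \<le> (\<Sum>a\<in>A. (if a = g y then 1 / 2 else 0) + 1 / (2 * card A))"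
      using pos by (intro sum_mono) (auto simp: lq_def exp_diff exp_minus field_simps)
    also have "\<dots> \<le> 1"
      using A pos by (simp add: sum.distrib)
    finally show ?thesis .
  qed
  \<comment> \<open>Log-ratio of test law to true law of \<open>(a, S, Y)\<close>. The true law is
    the product of the uniform weight \<open>1 / card A\<close>, the density of
    \<open>w = S - v a\<close>, and the density of \<open>Y - u a - l w\<close>; the last is a
    mixture because the interfering messages are averaged out. The Gaussian factor is taken at
    \<open>Y - c S\<close>, written out.\<close>
  define f where "f x z = (let (a, b) = x in
      ln (mixture n p A v (\<lambda>t. v a t + fst z t))
      + ln (gauss n \<sigma> (\<lambda>t. (u a t + k b t - c * v a t) + (l - c) * fst z t + 1 * snd z t))
      + lq a (restrict (\<lambda>t. (u a t + k b t) + (l * fst z t + snd z t)) {..<n})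
      + ln (card A) - ln (gauss n p (fst z)) - ln (mixture n q B k (\<lambda>t. k b t + snd z t)))" for x z
  interpret NP: prob_space "noise_pair n p q" using pq by (intro prob_space_noise_pair)
  interpret Z: prob_space "gauss_measure n r" using pos by (intro prob_space_gauss_measure)
  note G = noise_pair_ln_gauss[OF pq, of n _ "l - c" 1]
  note S = noise_pair_fst[OF pq(2) integrable_ln_mixture[OF pq(1) A(1)], of _ n v]
  note T = noise_pair_snd[OF pq(1,2) integrable_ln_mixture[OF pq(2) B(1)], of _ n k]
  note W = noise_pair_fst[OF pq(2) gauss_measure_ln_gauss(1)[OF pq(1)], of n]
  let ?E = "\<lambda>a b. {z \<in> space (gauss_measure n r). g (restrict (\<lambda>t. u a t + k b t + z t) {..<n}) \<noteq> a}"
  let ?L = "\<lambda>a b x. lq a (restrict (\<lambda>t. (u a t + k b t) + x t) {..<n})"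
  have Eset: "?E a b \<in> sets (gauss_measure n r)" for a b
  proof -
    have "(\<lambda>z. g (restrict (\<lambda>t. u a t + k b t + z t) {..<n})) \<in> gauss_measure n r \<rightarrow>\<^sub>M count_space UNIV"
      by (rule measurable_compose[OF measurable_block_restrict g])
        (simp add: gauss_measure_def block_component_measurable borel_measurable_add)
    from measurable_sets[OF this, of "- {a}"] show ?thesis
      by (simp add: vimage_def Int_def conj_commute)
  qed
  \<comment> \<open>An error costs an additional \<open>ln (card A)\<close> in the test weight; this
    is how the error probability enters.\<close>
  have L: "integrable (gauss_measure n r) (?L a b)"
    "(\<integral>x. ?L a b x \<partial>gauss_measure n r) = - ln 2 - ln (card A) * measure (gauss_measure n r) (?E a b)" for a b
  proof -
    have *: "?L a b x = - ln 2 - ln (card A) * indicator (?E a b) x" if "x \<in> space (gauss_measure n r)" for x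
      using that by (auto simp: lq_def indicator_def)
    have i0: "integrable (gauss_measure n r) (indicator (?E a b) :: _ \<Rightarrow> real)"
      using Eset[of a b] by (intro integrable_real_indicator) (auto simp: less_top[symmetric])
    then have i: "integrable (gauss_measure n r) (\<lambda>x. - ln 2 - ln (card A) * indicator (?E a b) x :: real)"
      by (intro Bochner_Integration.integrable_diff integrable_mult_right) simp_all
    then show "integrable (gauss_measure n r) (?L a b)"
      by (subst Bochner_Integration.integrable_cong[OF refl *])
    have "(\<integral>x. ?L a b x \<partial>gauss_measure n r) =
        (\<integral>x. - ln 2 - ln (card A) * indicator (?E a b) x \<partial>gauss_measure n r)"
      by (rule Bochner_Integration.integral_cong[OF refl *])
    also have "\<dots> = - ln 2 - ln (card A) * measure (gauss_measure n r) (?E a b)"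
      using Eset[of a b] i0 by (subst Bochner_Integration.integral_diff) (auto simp: Z.prob_space)
    finally show "(\<integral>x. ?L a b x \<partial>gauss_measure n r) =
        - ln 2 - ln (card A) * measure (gauss_measure n r) (?E a b)" .
  qed
  have Linv: "?L a b (restrict x {..<n}) = ?L a b x" for a b x
    by (simp cong: restrict_cong)
  note L' = noise_pair_sum[OF pq(1,2) L(1)[unfolded r_def] Linv]
  have int: "integrable (noise_pair n p q) (f x)" if x: "x \<in> A \<times> B" for x
  proof (cases x)
    case (Pair a b)
    with x have ab: "a \<in> A" "b \<in> B" by auto
    show ?thesis
      unfolding f_def Pair Let_def prod.case using S(1)[OF ab(1)] T(1)[OF ab(2)] G(1) W(1) L'(1)
      by (intro Bochner_Integration.integrable_add Bochner_Integration.integrable_diff NP.integrable_const)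
  qed
  have integral: "(\<integral>z. f (a, b) z \<partial>noise_pair n p q) =
      (\<integral>x. ln (mixture n p A v (\<lambda>t. v a t + x t)) \<partial>gauss_measure n p)
      + (- (real n / 2 * ln (2 * pi * \<sigma>))
         - ((\<Sum>t<n. (u a t + k b t - c * v a t)\<^sup>2) + n * ((l - c)\<^sup>2 * p + q)) / (2 * \<sigma>))
      + (- ln 2 - ln (card A) * measure (gauss_measure n r) (?E a b))
      + ln (card A) + real n / 2 * (ln (2 * pi * p) + 1)
      - (\<integral>x. ln (mixture n q B k (\<lambda>t. k b t + x t)) \<partial>gauss_measure n q)"
    if ab: "a \<in> A" "b \<in> B" for a b
  proof -
    have "(\<integral>z. f (a, b) z \<partial>noise_pair n p q) =
      (\<integral>z. ln (mixture n p A v (\<lambda>t. v a t + fst z t)) \<partial>noise_pair n p q)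
      + (\<integral>z. ln (gauss n \<sigma> (\<lambda>t. (u a t + k b t - c * v a t) + (l - c) * fst z t + 1 * snd z t)) \<partial>noise_pair n p q)
      + (\<integral>z. lq a (restrict (\<lambda>t. (u a t + k b t) + (l * fst z t + snd z t)) {..<n}) \<partial>noise_pair n p q)
      + (\<integral>z. ln (card A) \<partial>noise_pair n p q) - (\<integral>z. ln (gauss n p (fst z)) \<partial>noise_pair n p q)
      - (\<integral>z. ln (mixture n q B k (\<lambda>t. k b t + snd z t)) \<partial>noise_pair n p q)"
      unfolding f_def Let_def prod.case using S(1)[OF ab(1)] T(1)[OF ab(2)] G(1) W(1) L'(1)
      by (simp only: Bochner_Integration.integral_add Bochner_Integration.integral_diff
          Bochner_Integration.integrable_add Bochner_Integration.integrable_diff NP.integrable_const)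
    also have "\<dots> = (\<integral>x. ln (mixture n p A v (\<lambda>t. v a t + x t)) \<partial>gauss_measure n p)
      + (- (real n / 2 * ln (2 * pi * \<sigma>))
         - ((\<Sum>t<n. (u a t + k b t - c * v a t)\<^sup>2) + n * ((l - c)\<^sup>2 * p + 1\<^sup>2 * q)) / (2 * \<sigma>))
      + (- ln 2 - ln (card A) * measure (gauss_measure n r) (?E a b))
      + ln (card A) - (- (real n / 2 * (ln (2 * pi * p) + 1)))
      - (\<integral>x. ln (mixture n q B k (\<lambda>t. k b t + x t)) \<partial>gauss_measure n q)"
      by (simp only: S(2)[OF ab(1)] T(2)[OF ab(2)] G(2) W(2) L'(2) L(2)[unfolded r_def] r_def
          gauss_measure_ln_gauss(2)[OF pq(1)] NP.prob_space lebesgue_integral_const scaleR_one)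
    finally show ?thesis by simp
  qed
  have "(\<Sum>x\<in>A \<times> B. \<integral>\<^sup>+ z. ennreal (exp (f x z)) \<partial>noise_pair n p q) \<le> ennreal (card (A \<times> B))"
  proof -
    let ?K = "\<lambda>a s y. mixture n p A v s * gauss n \<sigma> (\<lambda>t. y t - c * s t) * exp (lq a (restrict y {..<n}))"
    \<comment> \<open>Here s is the genie noise w and j is interference plus receiver noise, so
      \<open>?y a s j\<close> is the received block and \<open>\<lambda>t. v a t + s t\<close> the
      genie's block.\<close>
    let ?y = "\<lambda>a s j t. (u a t + l * s t) + j t"
    let ?R = "\<lambda>a b s j. gauss n q (\<lambda>t. j t - k b t) / mixture n q B k j * (card A * ?K a (\<lambda>t. v a t + s t) (?y a s j))"
    note meas = measurable_compose[OF _ measurable_ennreal] borel_measurable_times borel_measurable_divide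
      gauss_measurable mixture_measurable measurable_compose[OF _ borel_measurable_exp] lqm
      borel_measurable_diff borel_measurable_add borel_measurable_const block_component_measurable
      fst_component_measurable snd_component_measurable
    note nonneg = mult_nonneg_nonneg divide_nonneg_nonneg gauss_nonneg mixture_nonneg exp_ge_zero
    interpret B: sigma_finite_measure ?B by (rule sigma_finite_block_lborel)
    have inner_measurable: "(\<lambda>x. \<integral>\<^sup>+ y. F x y \<partial>?B) \<in> borel_measurable ?B"
      if "(\<lambda>z. F (fst z) (snd z)) \<in> borel_measurable (?B \<Otimes>\<^sub>M ?B)" for F
      using B.borel_measurable_nn_integral_fst[OF that] by simp
    have 1: "(\<integral>\<^sup>+ z. ennreal (exp (f (a, b) z)) \<partial>noise_pair n p q) =
        (\<integral>\<^sup>+ s. \<integral>\<^sup>+ j. ennreal (?R a b s j) \<partial>?B \<partial>?B)" for a b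
    proof -
      have m: "(\<lambda>z. ennreal (exp (f (a, b) z))) \<in> borel_measurable (?B \<Otimes>\<^sub>M ?B)"
        unfolding f_def Let_def prod.case by (intro meas borel_measurable_ln)
      have "ennreal (gauss n p s * gauss n q j) * ennreal (exp (f (a, b) (s, j))) =
          ennreal (?R a b s (\<lambda>t. k b t + j t))" for s j
      proof -
        have y: "(u a t + k b t - c * v a t) + (l - c) * s t + 1 * j t = ?y a s (\<lambda>t. k b t + j t) t - c * (v a t + s t)"
          "(u a t + k b t) + (l * s t + j t) = ?y a s (\<lambda>t. k b t + j t) t" for t
          by (simp_all add: algebra_simps)
        have "exp (f (a, b) (s, j)) = ?K a (\<lambda>t. v a t + s t) (?y a s (\<lambda>t. k b t + j t)) * card A
            / gauss n p s / mixture n q B k (\<lambda>t. k b t + j t)"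
          unfolding f_def Let_def prod.case exp_diff exp_add fst_conv snd_conv y
          using pq pos A B by (simp add: gauss_pos mixture_pos)
        then have "gauss n p s * gauss n q j * exp (f (a, b) (s, j)) = ?R a b s (\<lambda>t. k b t + j t)"
          using gauss_pos[OF pq(1), of n s] by simp
        then show ?thesis
          by (subst ennreal_mult[symmetric]) (auto simp: gauss_nonneg)
      qed
      then have "(\<integral>\<^sup>+ z. ennreal (exp (f (a, b) z)) \<partial>noise_pair n p q) =
          (\<integral>\<^sup>+ s. \<integral>\<^sup>+ j. ennreal (?R a b s (\<lambda>t. k b t + j t)) \<partial>?B \<partial>?B)"
        unfolding nn_integral_noise_pair[OF m pq(1,2)] by simp
      also have "\<dots> = (\<integral>\<^sup>+ s. \<integral>\<^sup>+ j. ennreal (?R a b s j) \<partial>?B \<partial>?B)"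
      proof (rule nn_integral_cong)
        fix s
        show "(\<integral>\<^sup>+ j. ennreal (?R a b s (\<lambda>t. k b t + j t)) \<partial>?B) = (\<integral>\<^sup>+ j. ennreal (?R a b s j) \<partial>?B)"
        proof (rule nn_integral_block_translate[where F = "\<lambda>j. ennreal (?R a b s j)"])
          show "(\<lambda>j. ennreal (?R a b s j)) \<in> borel_measurable ?B" by (intro meas)
        qed (simp cong: gauss_cong mixture_cong restrict_cong)
      qed
      finally show ?thesis .
    qed
    \<comment> \<open>The index \<open>b\<close> survives only in the posterior quotient, which sums
      to \<open>card B\<close>. Afterwards j is translated to the received block and s to the
      genie's block, so that \<open>a\<close> remains only in the test weight.\<close>
    have 2: "(\<Sum>b\<in>B. \<integral>\<^sup>+ s. \<integral>\<^sup>+ j. ennreal (?R a b s j) \<partial>?B \<partial>?B) =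
        (\<integral>\<^sup>+ s. \<integral>\<^sup>+ y. ennreal (card A * card B * ?K a s y) \<partial>?B \<partial>?B)" for a
    proof -
      have Rm: "(\<lambda>z. ennreal (?R a b (fst z) (snd z))) \<in> borel_measurable (?B \<Otimes>\<^sub>M ?B)" for b
        by (intro meas)
      have Rm1: "(\<lambda>j. ennreal (?R a b s j)) \<in> borel_measurable ?B" for b s
        by (intro meas)
      have "(\<Sum>b\<in>B. ennreal (?R a b s j)) = ennreal (card A * card B * ?K a (\<lambda>t. v a t + s t) (?y a s j))" for s j
      proof -
        have "(\<Sum>b\<in>B. ennreal (?R a b s j)) = ennreal (\<Sum>b\<in>B. ?R a b s j)"
          by (intro sum_ennreal nonneg) simp
        also have "(\<Sum>b\<in>B. ?R a b s j) = card B * (card A * ?K a (\<lambda>t. v a t + s t) (?y a s j))"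
          unfolding sum_distrib_right[symmetric] sum_gauss_div_mixture[OF pq(2) B] ..
        finally show ?thesis by (simp only: mult_ac of_nat_mult)
      qed
      then have "(\<Sum>b\<in>B. \<integral>\<^sup>+ s. \<integral>\<^sup>+ j. ennreal (?R a b s j) \<partial>?B \<partial>?B) =
          (\<integral>\<^sup>+ s. \<integral>\<^sup>+ j. ennreal (card A * card B * ?K a (\<lambda>t. v a t + s t) (?y a s j)) \<partial>?B \<partial>?B)"
        by (simp only: nn_integral_sum[OF inner_measurable[OF Rm], symmetric]
            nn_integral_sum[OF Rm1, symmetric])
      also have "\<dots> = (\<integral>\<^sup>+ s. \<integral>\<^sup>+ y. ennreal (card A * card B * ?K a (\<lambda>t. v a t + s t) y) \<partial>?B \<partial>?B)"
      proof (rule nn_integral_cong)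
        fix s
        show "(\<integral>\<^sup>+ j. ennreal (card A * card B * ?K a (\<lambda>t. v a t + s t) (?y a s j)) \<partial>?B) =
            (\<integral>\<^sup>+ y. ennreal (card A * card B * ?K a (\<lambda>t. v a t + s t) y) \<partial>?B)"
        proof (rule nn_integral_block_translate[where F = "\<lambda>y. ennreal (card A * card B * ?K a (\<lambda>t. v a t + s t) y)"])
          show "(\<lambda>y. ennreal (card A * card B * ?K a (\<lambda>t. v a t + s t) y)) \<in> borel_measurable ?B"
            by (intro meas)
        qed (simp cong: gauss_cong)
      qed
      also have "\<dots> = (\<integral>\<^sup>+ s. \<integral>\<^sup>+ y. ennreal (card A * card B * ?K a s y) \<partial>?B \<partial>?B)"
      proof (rule nn_integral_block_translate[where F = "\<lambda>s. \<integral>\<^sup>+ y. ennreal (card A * card B * ?K a s y) \<partial>?B"])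
        show "(\<lambda>s. \<integral>\<^sup>+ y. ennreal (card A * card B * ?K a s y) \<partial>?B) \<in> borel_measurable ?B"
          by (intro inner_measurable meas)
      qed (simp cong: gauss_cong mixture_cong)
      finally show ?thesis .
    qed
    have "(\<Sum>x\<in>A \<times> B. \<integral>\<^sup>+ z. ennreal (exp (f x z)) \<partial>noise_pair n p q) =
        (\<Sum>a\<in>A. \<integral>\<^sup>+ s. \<integral>\<^sup>+ y. ennreal (card A * card B * ?K a s y) \<partial>?B \<partial>?B)"
      using 1 2 by (simp add: sum.cartesian_product' split_def)
    also have "\<dots> = (\<integral>\<^sup>+ s. \<integral>\<^sup>+ y. (\<Sum>a\<in>A. ennreal (card A * card B * ?K a s y)) \<partial>?B \<partial>?B)"
    proof -
      have Km: "(\<lambda>z. ennreal (card A * card B * ?K a (fst z) (snd z))) \<in> borel_measurable (?B \<Otimes>\<^sub>M ?B)" for a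
        by (intro meas)
      have Km1: "(\<lambda>y. ennreal (card A * card B * ?K a s y)) \<in> borel_measurable ?B" for a s
        by (intro meas)
      show ?thesis
        by (simp only: nn_integral_sum[OF inner_measurable[OF Km], symmetric]
            nn_integral_sum[OF Km1, symmetric])
    qed
    also have "\<dots> \<le> (\<integral>\<^sup>+ s. \<integral>\<^sup>+ y. ennreal (card A * card B) *
        ennreal (mixture n p A v s * gauss n \<sigma> (\<lambda>t. y t - c * s t)) \<partial>?B \<partial>?B)"
    proof (intro nn_integral_mono)
      fix s y
      let ?m = "mixture n p A v s * gauss n \<sigma> (\<lambda>t. y t - c * s t)"
      have "(\<Sum>a\<in>A. ennreal (card A * card B * ?K a s y)) = ennreal (\<Sum>a\<in>A. card A * card B * ?K a s y)"
        by (intro sum_ennreal nonneg) simp_all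
      also have "(\<Sum>a\<in>A. card A * card B * ?K a s y) = card A * card B * ?m * (\<Sum>a\<in>A. exp (lq a (restrict y {..<n})))"
        unfolding sum_distrib_left by (simp only: mult_ac)
      also have "ennreal \<dots> \<le> ennreal (card A * card B * ?m * 1)"
        by (intro ennreal_leI mult_left_mono lqsum nonneg) simp_all
      also have "\<dots> = ennreal (card A * card B) * ennreal ?m"
        unfolding mult_1_right by (intro ennreal_mult nonneg) simp_all
      finally show "(\<Sum>a\<in>A. ennreal (card A * card B * ?K a s y)) \<le> ennreal (card A * card B) * ennreal ?m" .
    qed
    also have "\<dots> = ennreal (card A * card B) * (\<integral>\<^sup>+ s. \<integral>\<^sup>+ y.
        ennreal (mixture n p A v s * gauss n \<sigma> (\<lambda>t. y t - c * s t)) \<partial>?B \<partial>?B)"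
    proof -
      have m: "(\<lambda>z. ennreal (mixture n p A v (fst z) * gauss n \<sigma> (\<lambda>t. snd z t - c * fst z t)))
          \<in> borel_measurable (?B \<Otimes>\<^sub>M ?B)"
        by (intro meas)
      have m1: "(\<lambda>y. ennreal (mixture n p A v s * gauss n \<sigma> (\<lambda>t. y t - c * s t))) \<in> borel_measurable ?B" for s
        by (intro meas)
      show ?thesis
        by (simp only: nn_integral_cmult[OF inner_measurable[OF m]] nn_integral_cmult[OF m1])
    qed
    also have "\<dots> = ennreal (card (A \<times> B))"
      by (simp only: nn_integral_mixture_gauss[OF pq(1,3) A] card_cartesian_product of_nat_mult mult_1_right)
    finally show ?thesis .
  qed
  then have "(\<Sum>x\<in>A \<times> B. \<integral>z. f x z \<partial>noise_pair n p q) \<le> 0"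
    using int NP.prob_space_axioms by (intro gibbs_inequality)
  moreover have "(\<Sum>x\<in>A \<times> B. \<integral>z. f x z \<partial>noise_pair n p q) = (card A * card B) *
      (- mixture_entropy n p A v - real n / 2 * ln (2 * pi * \<sigma>) - (D + n * ((l - c)\<^sup>2 * p + q)) / (2 * \<sigma>)
       - ln 2 - ln (card A) * err + ln (card A) + real n / 2 * (ln (2 * pi * p) + 1) + mixture_entropy n q B k)"
  proof -
    define C where "C = real (card A) * real (card B)"
    have C: "0 < C" using pos by (simp add: C_def)
    let ?s = "\<lambda>a. \<integral>x. ln (mixture n p A v (\<lambda>t. v a t + x t)) \<partial>gauss_measure n p"
    let ?t = "\<lambda>b. \<integral>x. ln (mixture n q B k (\<lambda>t. k b t + x t)) \<partial>gauss_measure n q"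
    let ?d = "\<lambda>a b. \<Sum>t<n. (u a t + k b t - c * v a t)\<^sup>2"
    let ?e = "\<lambda>a b. measure (gauss_measure n r) (?E a b)"
    let ?c = "- (real n / 2 * ln (2 * pi * \<sigma>)) - n * ((l - c)\<^sup>2 * p + q) / (2 * \<sigma>) - ln 2 + ln (card A)
      + real n / 2 * (ln (2 * pi * p) + 1)"
    have sums: "(\<Sum>a\<in>A. \<Sum>b\<in>B. s a - t b - d a b / K - L * e a b + c0) =
        card B * (\<Sum>a\<in>A. s a) - card A * (\<Sum>b\<in>B. t b)
        - (\<Sum>a\<in>A. \<Sum>b\<in>B. d a b) / K - L * (\<Sum>a\<in>A. \<Sum>b\<in>B. e a b) + C * c0"
      for s :: "'a \<Rightarrow> real" and t :: "'b \<Rightarrow> real" and d e :: "'a \<Rightarrow> 'b \<Rightarrow> real" and K L c0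
      by (simp add: sum.distrib sum_subtractf sum_distrib_left[symmetric] sum_divide_distrib[symmetric] C_def)
    have "(\<Sum>x\<in>A \<times> B. \<integral>z. f x z \<partial>noise_pair n p q) =
        (\<Sum>a\<in>A. \<Sum>b\<in>B. ?s a - ?t b - ?d a b / (2 * \<sigma>) - ln (card A) * ?e a b + ?c)"
      unfolding sum.cartesian_product'
      by (intro sum.cong refl) (simp add: integral add_divide_distrib)
    also have "\<dots> = card B * (\<Sum>a\<in>A. ?s a) - card A * (\<Sum>b\<in>B. ?t b)
        - (\<Sum>a\<in>A. \<Sum>b\<in>B. ?d a b) / (2 * \<sigma>) - ln (card A) * (\<Sum>a\<in>A. \<Sum>b\<in>B. ?e a b) + C * ?c"
      by (rule sums)
    also have "(\<Sum>a\<in>A. ?s a) = - (card A * mixture_entropy n p A v)"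
      using pos by (simp add: mixture_entropy_def)
    also have "(\<Sum>b\<in>B. ?t b) = - (card B * mixture_entropy n q B k)"
      using pos by (simp add: mixture_entropy_def)
    also have "(\<Sum>a\<in>A. \<Sum>b\<in>B. ?d a b) = C * D"
      using pos by (simp add: D_def C_def sum.cartesian_product' split_def)
    also have "(\<Sum>a\<in>A. \<Sum>b\<in>B. ?e a b) = C * err"
      using pos by (simp add: err_def C_def r_def sum.cartesian_product' split_def)
    finally show ?thesis
      by (simp add: C_def algebra_simps add_divide_distrib)
  qed
  ultimately have "- mixture_entropy n p A v - real n / 2 * ln (2 * pi * \<sigma>) - (D + n * ((l - c)\<^sup>2 * p + q)) / (2 * \<sigma>)
       - ln 2 - ln (card A) * err + ln (card A) + real n / 2 * (ln (2 * pi * p) + 1) + mixture_entropy n q B k \<le> 0"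
    using pos by (simp add: mult_le_0_iff)
  then show ?thesis
    by (simp add: algebra_simps)
qed

text \<open>The mixed terms factor through the mean of \<open>y\<close> at each time, which is zero;
  centring one of the two families is enough.\<close>

lemma sum_squares_centered:
  fixes y :: "'a \<Rightarrow> nat \<Rightarrow> real" and z :: "'b \<Rightarrow> nat \<Rightarrow> real"
  assumes "\<And>t. t < n \<Longrightarrow> (\<Sum>a\<in>A. y a t) = 0"
  shows "(\<Sum>(a, b)\<in>A \<times> B. \<Sum>t<n. (y a t + z b t)\<^sup>2) =
    card B * (\<Sum>a\<in>A. \<Sum>t<n. (y a t)\<^sup>2) + card A * (\<Sum>b\<in>B. \<Sum>t<n. (z b t)\<^sup>2)"
proof -
  have "(\<Sum>a\<in>A. \<Sum>t<n. 2 * y a t * z b t) = 0" for b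
  proof -
    have "(\<Sum>a\<in>A. \<Sum>t<n. 2 * y a t * z b t) = (\<Sum>t<n. \<Sum>a\<in>A. 2 * y a t * z b t)"
      by (rule sum.swap)
    also have "\<dots> = (\<Sum>t<n. 2 * z b t * (\<Sum>a\<in>A. y a t))"
      by (intro sum.cong refl) (simp add: sum_distrib_left mult_ac)
    also have "\<dots> = 0" using assms by simp
    finally show ?thesis .
  qed
  then have 0: "(\<Sum>a\<in>A. \<Sum>b\<in>B. \<Sum>t<n. 2 * y a t * z b t) = 0"
    by (subst sum.swap) simp
  have "(\<Sum>(a, b)\<in>A \<times> B. \<Sum>t<n. (y a t + z b t)\<^sup>2) =
      (\<Sum>a\<in>A. \<Sum>b\<in>B. (\<Sum>t<n. (y a t)\<^sup>2) + (\<Sum>t<n. (z b t)\<^sup>2) + (\<Sum>t<n. 2 * y a t * z b t))"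
    unfolding sum.cartesian_product[symmetric] by (simp add: power2_sum sum.distrib)
  also have "\<dots> = card B * (\<Sum>a\<in>A. \<Sum>t<n. (y a t)\<^sup>2) + card A * (\<Sum>b\<in>B. \<Sum>t<n. (z b t)\<^sup>2)"
    by (simp only: sum.distrib 0) (simp add: sum_distrib_left)
  finally show ?thesis .
qed

lemma sum_squares_codebooks_le:
  fixes x1 x2 :: "nat \<Rightarrow> nat \<Rightarrow> real" and \<alpha> \<beta> P1 P2 :: real
  assumes "\<And>t. t < n \<Longrightarrow> (\<Sum>m\<in>M1. x1 m t) = 0"
    and "(\<Sum>m\<in>M1. \<Sum>t<n. (x1 m t)\<^sup>2) \<le> card M1 * (n * P1)"
    and "(\<Sum>m\<in>M2. \<Sum>t<n. (x2 m t)\<^sup>2) \<le> card M2 * (n * P2)"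
  shows "(\<Sum>a\<in>M1 \<times> M2. \<Sum>t<n. (\<alpha> * x1 (fst a) t + \<beta> * x2 (snd a) t)\<^sup>2)
    \<le> card (M1 \<times> M2) * (n * (\<alpha>\<^sup>2 * P1 + \<beta>\<^sup>2 * P2))"
proof -
  have "(\<Sum>a\<in>M1 \<times> M2. \<Sum>t<n. (\<alpha> * x1 (fst a) t + \<beta> * x2 (snd a) t)\<^sup>2) =
      (\<Sum>(m1, m2)\<in>M1 \<times> M2. \<Sum>t<n. (\<alpha> * x1 m1 t + \<beta> * x2 m2 t)\<^sup>2)"
    by (simp add: split_def)
  also have "\<dots> = card M2 * (\<Sum>m\<in>M1. \<Sum>t<n. (\<alpha> * x1 m t)\<^sup>2) + card M1 * (\<Sum>m\<in>M2. \<Sum>t<n. (\<beta> * x2 m t)\<^sup>2)"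
    by (rule sum_squares_centered) (simp add: assms(1) sum_distrib_left[symmetric])
  also have "\<dots> = card M2 * (\<alpha>\<^sup>2 * (\<Sum>m\<in>M1. \<Sum>t<n. (x1 m t)\<^sup>2)) + card M1 * (\<beta>\<^sup>2 * (\<Sum>m\<in>M2. \<Sum>t<n. (x2 m t)\<^sup>2))"
    by (simp add: power_mult_distrib sum_distrib_left[symmetric])
  also have "\<dots> \<le> card M2 * (\<alpha>\<^sup>2 * (card M1 * (n * P1))) + card M1 * (\<beta>\<^sup>2 * (card M2 * (n * P2)))"
    using assms by (intro add_mono mult_left_mono) auto
  also have "\<dots> = card (M1 \<times> M2) * (n * (\<alpha>\<^sup>2 * P1 + \<beta>\<^sup>2 * P2))"
    by (simp add: card_cartesian_product algebra_simps)
  finally show ?thesis .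
qed

text \<open>
  The variance of \<open>Y - c S\<close> for independent inputs of full power.
\<close>

definition genie_variance :: "real \<Rightarrow> real \<Rightarrow> real \<Rightarrow> real \<Rightarrow> real \<Rightarrow> real \<Rightarrow> real \<Rightarrow> real" where
  "genie_variance P1 P2 h1 h2 \<rho> \<eta> c =
     (1 - c * h1)\<^sup>2 * P1 + (1 - c * h2)\<^sup>2 * P2 + INR P1 P2 h1 h2 + (\<rho> - c * \<eta>)\<^sup>2 + (1 - \<rho>\<^sup>2)"

text \<open>The genie bound with \<open>p = \<eta>\<^sup>2\<close>,
  \<open>q = 1 - \<rho>\<^sup>2\<close> and \<open>l = \<rho> / \<eta>\<close>. Testing with
  variance \<sigma> equal to the largest second moment of \<open>Y - c S\<close> that the power
  constraints allow makes the quadratic term at most \<open>n / 2\<close>.\<close>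

lemma receiver_bound:
  fixes n :: nat and x1 x2 x3 x4 :: "nat \<Rightarrow> nat \<Rightarrow> real" and g :: "(nat \<Rightarrow> real) \<Rightarrow> nat \<times> nat"
    and M1 M2 M3 M4 :: "nat set" and P1 P2 h1 h2 \<rho> \<eta> c :: real
  assumes \<rho>\<eta>: "\<eta> \<noteq> 0" "\<rho>\<^sup>2 < 1" and P: "0 \<le> P1" "0 \<le> P2"
    and M: "finite M1" "M1 \<noteq> {}" "finite M2" "M2 \<noteq> {}" "finite M3" "M3 \<noteq> {}" "finite M4" "M4 \<noteq> {}"
    and cent: "\<And>t. t < n \<Longrightarrow> (\<Sum>m\<in>M1. x1 m t) = 0" "\<And>t. t < n \<Longrightarrow> (\<Sum>m\<in>M2. x2 m t) = 0"
      "\<And>t. t < n \<Longrightarrow> (\<Sum>m\<in>M3. x3 m t) = 0"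
    and power: "(\<Sum>m\<in>M1. \<Sum>t<n. (x1 m t)\<^sup>2) \<le> card M1 * (n * P1)"
      "(\<Sum>m\<in>M2. \<Sum>t<n. (x2 m t)\<^sup>2) \<le> card M2 * (n * P2)"
      "(\<Sum>m\<in>M3. \<Sum>t<n. (x3 m t)\<^sup>2) \<le> card M3 * (n * P1)"
      "(\<Sum>m\<in>M4. \<Sum>t<n. (x4 m t)\<^sup>2) \<le> card M4 * (n * P2)"
    and g: "g \<in> block_lborel n \<rightarrow>\<^sub>M count_space UNIV"
    and err: "(\<Sum>(a, b)\<in>(M1 \<times> M2) \<times> (M3 \<times> M4). measure (gauss_measure n 1)
      {z \<in> space (gauss_measure n 1). g (restrict (\<lambda>t. x1 (fst a) t + x2 (snd a) t
        + (h1 * x3 (fst b) t + h2 * x4 (snd b) t) + z t) {..<n}) \<noteq> a})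
      / (card (M1 \<times> M2) * card (M3 \<times> M4)) \<le> \<epsilon>"
  defines "\<sigma> \<equiv> genie_variance P1 P2 h1 h2 \<rho> \<eta> c"
  shows "(1 - \<epsilon>) * ln (card (M1 \<times> M2)) - ln 2 \<le>
      mixture_entropy n (\<eta>\<^sup>2) (M1 \<times> M2) (\<lambda>a t. h1 * x1 (fst a) t + h2 * x2 (snd a) t)
      - mixture_entropy n (1 - \<rho>\<^sup>2) (M3 \<times> M4) (\<lambda>b t. h1 * x3 (fst b) t + h2 * x4 (snd b) t)
      + n / 2 * ln (\<sigma> / \<eta>\<^sup>2)"
proof -
  let ?A = "M1 \<times> M2" and ?B = "M3 \<times> M4"
  let ?u = "\<lambda>a t. x1 (fst a) t + x2 (snd a) t" and ?v = "\<lambda>a t. h1 * x1 (fst a) t + h2 * x2 (snd a) t"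
    and ?k = "\<lambda>b t. h1 * x3 (fst b) t + h2 * x4 (snd b) t"
  have pq: "0 < \<eta>\<^sup>2" "0 < 1 - \<rho>\<^sup>2" using \<rho>\<eta> by simp_all
  have \<sigma>: "0 < \<sigma>"
    unfolding \<sigma>_def genie_variance_def INR_def using P pq by (intro add_nonneg_pos add_nonneg_nonneg) auto
  \<comment> \<open>The genie noise and the remaining noise recombine to the unit receiver
    noise.\<close>
  have r: "1 - \<rho>\<^sup>2 + (\<rho> / \<eta>)\<^sup>2 * \<eta>\<^sup>2 = 1"
    using \<rho>\<eta> by (simp add: power_divide)
  have fin: "finite ?A" "?A \<noteq> {}" "finite ?B" "?B \<noteq> {}" using M by auto
  have card: "0 < real (card ?A)" "0 < real (card ?B)" using fin by (auto simp only: card_gt_0_iff of_nat_0_less_iff)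
  have "(\<Sum>(a, b)\<in>?A \<times> ?B. \<Sum>t<n. (?u a t + ?k b t - c * ?v a t)\<^sup>2)
      = (\<Sum>(a, b)\<in>?A \<times> ?B. \<Sum>t<n. (((1 - c * h1) * x1 (fst a) t + (1 - c * h2) * x2 (snd a) t) + ?k b t)\<^sup>2)"
    by (simp add: algebra_simps)
  also have "\<dots> = card ?B * (\<Sum>a\<in>?A. \<Sum>t<n. ((1 - c * h1) * x1 (fst a) t + (1 - c * h2) * x2 (snd a) t)\<^sup>2)
      + card ?A * (\<Sum>b\<in>?B. \<Sum>t<n. (?k b t)\<^sup>2)"
  proof (rule sum_squares_centered)
    fix t assume "t < n"
    then show "(\<Sum>a\<in>?A. (1 - c * h1) * x1 (fst a) t + (1 - c * h2) * x2 (snd a) t) = 0"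
      using cent(1,2)[of t] by (simp add: sum.cartesian_product' sum.distrib sum_distrib_left[symmetric])
  qed
  also have "\<dots> \<le> card ?B * (card ?A * (n * ((1 - c * h1)\<^sup>2 * P1 + (1 - c * h2)\<^sup>2 * P2)))
      + card ?A * (card ?B * (n * (h1\<^sup>2 * P1 + h2\<^sup>2 * P2)))"
    using cent power by (intro add_mono mult_left_mono sum_squares_codebooks_le) auto
  also have "\<dots> = n * (\<sigma> - ((\<rho> - c * \<eta>)\<^sup>2 + (1 - \<rho>\<^sup>2))) * (card ?A * card ?B)"
    by (simp add: \<sigma>_def genie_variance_def INR_def algebra_simps)
  finally have "(\<Sum>(a, b)\<in>?A \<times> ?B. \<Sum>t<n. (?u a t + ?k b t - c * ?v a t)\<^sup>2) / (card ?A * card ?B)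
      \<le> n * (\<sigma> - ((\<rho> - c * \<eta>)\<^sup>2 + (1 - \<rho>\<^sup>2)))"
    using card by (simp only: pos_divide_le_eq mult_pos_pos of_nat_mult)
  moreover have "(\<rho> - c * \<eta>)\<^sup>2 = (\<rho> / \<eta> - c)\<^sup>2 * \<eta>\<^sup>2"
    using \<rho>\<eta> by (simp add: power_mult_distrib[symmetric] left_diff_distrib)
  \<comment> \<open>The bound \<open>n / 2\<close> cancels the \<open>- 1\<close> coming from the
    entropy of the genie noise.\<close>
  ultimately have D: "((\<Sum>(a, b)\<in>?A \<times> ?B. \<Sum>t<n. (?u a t + ?k b t - c * ?v a t)\<^sup>2) / (card ?A * card ?B)
      + n * ((\<rho> / \<eta> - c)\<^sup>2 * \<eta>\<^sup>2 + (1 - \<rho>\<^sup>2))) / (2 * \<sigma>) \<le> n / 2"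
    using \<sigma> by (subst pos_divide_le_eq) (auto simp: algebra_simps)
  \<comment> \<open>Nonnegativity allows the actual error to be replaced by its upper bound
    \<epsilon>.\<close>
  have L: "0 \<le> ln (real (card ?A))"
    using card(1) by (intro ln_ge_zero) (metis One_nat_def Suc_leI of_nat_0_less_iff of_nat_1 of_nat_le_iff)
  note genie_bound[OF pq \<sigma> fin g, where l = "\<rho> / \<eta>" and c = c and u = ?u and v = ?v and k = ?k, unfolded r]
  moreover note mult_right_mono[OF err L] D
  ultimately have "(1 - \<epsilon>) * ln (card ?A) - ln 2 \<le>
      mixture_entropy n (\<eta>\<^sup>2) ?A ?v - mixture_entropy n (1 - \<rho>\<^sup>2) ?B ?k
      + n / 2 * (ln (2 * pi * \<sigma>) - ln (2 * pi * \<eta>\<^sup>2) - 1) + n / 2"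
    unfolding left_diff_distrib by linarith
  also have "\<dots> = mixture_entropy n (\<eta>\<^sup>2) ?A ?v - mixture_entropy n (1 - \<rho>\<^sup>2) ?B ?k
      + n / 2 * (ln (2 * pi * \<sigma>) - ln (2 * pi * \<eta>\<^sup>2))"
    by (simp add: algebra_simps)
  also have "ln (2 * pi * \<sigma>) - ln (2 * pi * \<eta>\<^sup>2) = ln (\<sigma> / \<eta>\<^sup>2)"
    using \<sigma> pq by (simp add: ln_div ln_mult)
  finally show ?thesis .
qed

text \<open>At full power the numerator of c is the covariance of Y and S, and the denominator the
  variance of S, so c minimizes the quadratic \<open>genie_variance\<close>. The first factor on the
  left is the one from the entropy increment; it cancels the denominator of the minimum.\<close>

lemma genie_variance_optimal:
  fixes P1 P2 h1 h2 \<rho> \<eta> :: real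
  assumes "0 \<le> P1" "0 \<le> P2" "\<eta> \<noteq> 0" "\<rho>\<^sup>2 < 1"
  defines "I \<equiv> INR P1 P2 h1 h2"
  defines "c \<equiv> (h1 * P1 + h2 * P2 + \<rho> * \<eta>) / (I + \<eta>\<^sup>2)"
  shows "(I + \<eta>\<^sup>2) / (I + (1 - \<rho>\<^sup>2)) * (genie_variance P1 P2 h1 h2 \<rho> \<eta> c / \<eta>\<^sup>2) =
    1 + 1 / \<eta>\<^sup>2 * (I + bound_A P1 P2 h1 h2 \<rho> \<eta> / (1 - \<rho>\<^sup>2 + I))"
proof -
  let ?T = "h1 * P1 + h2 * P2 + \<rho> * \<eta>" and ?q = "1 - \<rho>\<^sup>2" and ?V = "genie_variance P1 P2 h1 h2 \<rho> \<eta> c"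
  have I0: "0 \<le> I" using assms by (simp add: I_def INR_def)
  have "0 < \<eta>\<^sup>2" "0 < ?q" using assms by simp_all
  with I0 have pos: "0 < I + \<eta>\<^sup>2" "0 < I + ?q" by linarith+
  have "c * (I + \<eta>\<^sup>2) = ?T" using pos by (simp add: c_def)
  have V: "?V = (P1 + P2 + I + 1) - 2 * c * ?T + c\<^sup>2 * (I + \<eta>\<^sup>2)"
    unfolding genie_variance_def I_def INR_def by (simp add: power2_eq_square algebra_simps)
  have "(I + \<eta>\<^sup>2) * ?V = (P1 + P2 + I + 1) * (I + \<eta>\<^sup>2) - 2 * (c * (I + \<eta>\<^sup>2)) * ?T + (c * (I + \<eta>\<^sup>2))\<^sup>2"
    unfolding V by (simp add: power2_eq_square algebra_simps)
  \<comment> \<open>The determinant of the covariance matrix of \<open>(Y, S)\<close>, with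
    \<open>P1 + P2 + I + 1\<close> the variance of Y; expanding it yields
    \<open>bound_A\<close>.\<close>
  also have "\<dots> = (P1 + P2 + I + 1) * (I + \<eta>\<^sup>2) - ?T\<^sup>2"
    unfolding \<open>c * (I + \<eta>\<^sup>2) = ?T\<close> by (simp add: power2_eq_square)
  also have "\<dots> = (I + \<eta>\<^sup>2) * (I + ?q) + bound_A P1 P2 h1 h2 \<rho> \<eta>"
    unfolding I_def INR_def bound_A_def by (simp add: power2_eq_square algebra_simps)
  finally have V': "(I + \<eta>\<^sup>2) * ?V = (I + \<eta>\<^sup>2) * (I + ?q) + bound_A P1 P2 h1 h2 \<rho> \<eta>" .
  have "(I + \<eta>\<^sup>2) / (I + ?q) * (?V / \<eta>\<^sup>2) = ((I + \<eta>\<^sup>2) * ?V) / ((I + ?q) * \<eta>\<^sup>2)"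
    by simp
  also have "\<dots> = ((I + \<eta>\<^sup>2) * (I + ?q)) / ((I + ?q) * \<eta>\<^sup>2) + bound_A P1 P2 h1 h2 \<rho> \<eta> / ((I + ?q) * \<eta>\<^sup>2)"
    unfolding V' by (rule add_divide_distrib)
  also have "((I + \<eta>\<^sup>2) * (I + ?q)) / ((I + ?q) * \<eta>\<^sup>2) = 1 + I / \<eta>\<^sup>2"
    using pos \<open>\<eta> \<noteq> 0\<close> by (simp add: add_divide_distrib)
  finally show ?thesis
    by (simp add: distrib_left add.commute mult.commute)
qed

section \<open>Codes\<close>

lemma finite_message_set: "finite (message_set n r)"
  by (simp add: message_set_def)

lemma message_set_nonempty: "message_set n r \<noteq> {}"
  by (simp add: message_set_def Suc_le_eq)

text \<open>Rounding up can only enlarge the message set.\<close>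

lemma ln_card_message_set: "n * r * ln 2 \<le> ln (card (message_set n r))"
proof -
  have "2 powr (n * r) \<le> card (message_set n r)"
    by (simp add: message_set_def)
  then have "ln (2 powr (n * r)) \<le> ln (card (message_set n r))"
    by (intro ln_mono) auto
  then show ?thesis by (simp add: ln_powr)
qed

lemma decoding_error_measurable:
  assumes code: "is_code P1 P2 n R f g"
  shows "(\<lambda>z. \<exists>s. decoded h1 h2 n f g (m, z) s \<noteq> fst (m, z) s) \<in> noise_pair n p q \<rightarrow>\<^sub>M count_space UNIV"
proof -
  let ?N = "noise_pair n p q"
  have out: "(\<lambda>z. output1 n h1 h2 x (fst z)) \<in> ?N \<rightarrow>\<^sub>M (\<Pi>\<^sub>M t\<in>{..<n}. borel)"
    "(\<lambda>z. output2 n h1 h2 x (snd z)) \<in> ?N \<rightarrow>\<^sub>M (\<Pi>\<^sub>M t\<in>{..<n}. borel)" for x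
  proof -
    have "(\<lambda>z. fst z t) \<in> borel_measurable ?N" "(\<lambda>z. snd z t) \<in> borel_measurable ?N" if "t < n" for t
      using that by (auto intro: measurable_noise_pair fst_component_measurable snd_component_measurable)
    then show "(\<lambda>z. output1 n h1 h2 x (fst z)) \<in> ?N \<rightarrow>\<^sub>M (\<Pi>\<^sub>M t\<in>{..<n}. borel)"
      "(\<lambda>z. output2 n h1 h2 x (snd z)) \<in> ?N \<rightarrow>\<^sub>M (\<Pi>\<^sub>M t\<in>{..<n}. borel)"
      unfolding output1_def output2_def
      by (auto intro!: measurable_restrict borel_measurable_add borel_measurable_times)
  qed
  have "(\<lambda>z. decoded h1 h2 n f g (m, z) s \<noteq> m s) \<in> ?N \<rightarrow>\<^sub>M count_space UNIV" for s
  proof -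
    have "g s \<in> (\<Pi>\<^sub>M t\<in>{..<n}. borel) \<rightarrow>\<^sub>M count_space (message_set n (R $ s))"
      using code by (simp add: is_code_def)
    then have gs: "(\<lambda>y. g s y \<noteq> m s) \<in> (\<Pi>\<^sub>M t\<in>{..<n}. borel) \<rightarrow>\<^sub>M count_space UNIV"
      by (rule measurable_compose) simp
    show ?thesis
      unfolding decoded_def split_beta fst_conv snd_conv
      by (cases "s = 1 \<or> s = 2") (simp_all add: measurable_compose[OF out(1) gs] measurable_compose[OF out(2) gs])
  qed
  then show ?thesis by (simp, measurable)
qed

text \<open>\<open>\<phi>\<close> stands for the conditional error probability of one receiver,
  which the joint error event dominates for every message tuple; averaging over the uniform tuple
  gives the claim. The order of the indices lists the receiver's own transmitters first, so both
  receivers are covered.\<close>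

lemma receiver_error_le:
  fixes \<phi> :: "(nat \<times> nat) \<times> (nat \<times> nat) \<Rightarrow> real"
  assumes idx: "distinct [i, j, k, l]" "UNIV = {i, j, k, l :: 4}"
    and code: "is_code P1 P2 n R f g"
    and \<phi>: "\<And>m. (\<And>s. m s \<in> message_set n (R $ s)) \<Longrightarrow> \<phi> ((m i, m j), (m k, m l)) \<le>
      measure (noise_pair n 1 1) {z \<in> space (noise_pair n 1 1). \<exists>s. decoded h1 h2 n f g (m, z) s \<noteq> m s}"
  defines "M \<equiv> \<lambda>s. message_set n (R $ s)"
  shows "(\<Sum>x\<in>(M i \<times> M j) \<times> (M k \<times> M l). \<phi> x) / (card (M i \<times> M j) * card (M k \<times> M l))
    \<le> error_prob h1 h2 n R f g"
proof -
  let ?N = "noise_pair n 1 1" and ?D = "PiE_dflt UNIV 0 M"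
  interpret N: prob_space ?N by (intro prob_space_noise_pair) simp_all
  have D: "?D = {m. \<forall>s. m s \<in> M s}" by (auto simp: PiE_dflt_def)
  define T where "T x s = (if s = i then fst (fst x) else if s = j then snd (fst x)
      else if s = k then fst (snd x) else snd (snd x))" for x :: "(nat \<times> nat) \<times> (nat \<times> nat)" and s :: 4
  have bij: "bij_betw (\<lambda>m. ((m i, m j), (m k, m l))) ?D ((M i \<times> M j) \<times> (M k \<times> M l))"
  proof (rule bij_betw_byWitness[where f' = T])
    have cover: "s = i \<or> s = j \<or> s = k \<or> s = l" for s
      using idx(2) by (metis UNIV_I insertE empty_iff)
    show "\<forall>m\<in>?D. T ((m i, m j), (m k, m l)) = m"
      using cover by (auto simp: T_def fun_eq_iff)
    show "\<forall>x\<in>(M i \<times> M j) \<times> (M k \<times> M l). ((T x i, T x j), (T x k, T x l)) = x"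
      using idx(1) by (auto simp: T_def)
    show "(\<lambda>m. ((m i, m j), (m k, m l))) ` ?D \<subseteq> (M i \<times> M j) \<times> (M k \<times> M l)"
      by (auto simp: D)
    show "T ` ((M i \<times> M j) \<times> (M k \<times> M l)) \<subseteq> ?D"
      using cover by (fastforce simp: D T_def)
  qed
  have finD: "finite ?D" "?D \<noteq> {}"
  proof -
    have "finite ((M i \<times> M j) \<times> (M k \<times> M l))" "(M i \<times> M j) \<times> (M k \<times> M l) \<noteq> {}"
      by (auto simp: M_def finite_message_set message_set_nonempty)
    then show "finite ?D" "?D \<noteq> {}"
      using bij_betw_finite[OF bij] bij_betw_imp_surj_on[OF bij]
      by (auto simp: M_def message_set_nonempty)
  qed
  have cardD: "card ?D = card (M i \<times> M j) * card (M k \<times> M l)"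
    using bij_betw_same_card[OF bij] by (simp add: card_cartesian_product)
  let ?P = "Pi_pmf UNIV 0 (\<lambda>s. message_law n (R $ s))"
  have P: "?P = pmf_of_set ?D"
    unfolding message_law_def M_def by (rule Pi_pmf_of_set) (auto simp: finite_message_set message_set_nonempty)
  have space: "imac_space n R = measure_pmf ?P \<Otimes>\<^sub>M ?N"
    by (simp add: imac_space_def noise_law_eq)
  let ?Q = "\<lambda>\<omega>. \<exists>s. decoded h1 h2 n f g \<omega> s \<noteq> fst \<omega> s"
  note slice = decoding_error_measurable[OF code]
  \<comment> \<open>Message tuples are countably many, so measurability in the noise for each fixed
    tuple suffices.\<close>
  have "?Q \<in> count_space UNIV \<Otimes>\<^sub>M ?N \<rightarrow>\<^sub>M count_space UNIV"
    by (rule measurable_pair_measure_countable1) (use slice in auto)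
  then have Q: "?Q \<in> measure_pmf ?P \<Otimes>\<^sub>M ?N \<rightarrow>\<^sub>M count_space UNIV"
    by (subst measurable_cong_sets[OF sets_pair_measure_cong[OF sets_measure_pmf_count_space refl] refl])
  then have E: "{\<omega> \<in> space (measure_pmf ?P \<Otimes>\<^sub>M ?N). ?Q \<omega>} \<in> sets (measure_pmf ?P \<Otimes>\<^sub>M ?N)" (is "?E \<in> _")
    by (simp add: pred_def)
  let ?S = "\<lambda>m. {z \<in> space ?N. \<exists>s. decoded h1 h2 n f g (m, z) s \<noteq> m s}"
  interpret PN: pair_prob_space "measure_pmf ?P" ?N ..
  have "ennreal (error_prob h1 h2 n R f g) = emeasure (measure_pmf ?P \<Otimes>\<^sub>M ?N) ?E"
    by (simp add: error_prob_def space PN.emeasure_eq_measure)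
  also have "\<dots> = (\<integral>\<^sup>+ m. emeasure ?N (Pair m -` ?E) \<partial>measure_pmf ?P)"
    by (rule N.emeasure_pair_measure_alt[OF E])
  also have "\<dots> = (\<integral>\<^sup>+ m. ennreal (measure ?N (?S m)) \<partial>measure_pmf ?P)"
    by (intro nn_integral_cong) (simp add: N.emeasure_eq_measure vimage_def space_pair_measure)
  also have "\<dots> = (\<Sum>m\<in>?D. ennreal (measure ?N (?S m))) / card ?D"
    unfolding P using finD by (subst nn_integral_pmf_of_set) auto
  also have "\<dots> = ennreal ((\<Sum>m\<in>?D. measure ?N (?S m)) / card ?D)"
    using finD by (simp add: divide_ennreal sum_nonneg card_gt_0_iff ennreal_of_nat_eq_real_of_nat)
  finally have "error_prob h1 h2 n R f g = (\<Sum>m\<in>?D. measure ?N (?S m)) / card ?D"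
    by (simp add: error_prob_def sum_nonneg)
  also have "\<dots> \<ge> (\<Sum>m\<in>?D. \<phi> ((m i, m j), (m k, m l))) / card ?D"
    by (intro divide_right_mono sum_mono \<phi>) (auto simp: PiE_dflt_def M_def)
  also have "(\<Sum>m\<in>?D. \<phi> ((m i, m j), (m k, m l))) = (\<Sum>x\<in>(M i \<times> M j) \<times> (M k \<times> M l). \<phi> x)"
    by (rule sum.reindex_bij_betw[OF bij])
  finally show ?thesis by (simp add: cardD)
qed


text \<open>An event about one receiver's noise is a cylinder, whose probability the other noise
  does not change.\<close>

lemma measure_gauss_le_noise_pair:
  assumes "E \<in> sets (noise_pair n 1 1)" "S \<in> sets (gauss_measure n 1)"
  shows "S \<times> space (block_lborel n) \<subseteq> E \<Longrightarrow> measure (gauss_measure n 1) S \<le> measure (noise_pair n 1 1) E"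
    and "space (block_lborel n) \<times> S \<subseteq> E \<Longrightarrow> measure (gauss_measure n 1) S \<le> measure (noise_pair n 1 1) E"
proof -
  interpret G: prob_space "gauss_measure n 1" by (intro prob_space_gauss_measure) simp
  interpret N: prob_space "noise_pair n 1 1" by (intro prob_space_noise_pair) simp_all
  let ?U = "space (gauss_measure n 1)"
  have "measure (noise_pair n 1 1) (S \<times> ?U) = measure (gauss_measure n 1) S"
    "measure (noise_pair n 1 1) (?U \<times> S) = measure (gauss_measure n 1) S"
    using assms by (simp_all add: measure_def G.emeasure_pair_measure_Times G.emeasure_space_1)
  then show "S \<times> space (block_lborel n) \<subseteq> E \<Longrightarrow> measure (gauss_measure n 1) S \<le> measure (noise_pair n 1 1) E"
    "space (block_lborel n) \<times> S \<subseteq> E \<Longrightarrow> measure (gauss_measure n 1) S \<le> measure (noise_pair n 1 1) E"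
    using N.finite_measure_mono[OF _ assms(1), of "S \<times> ?U"] N.finite_measure_mono[OF _ assms(1), of "?U \<times> S"]
    by (auto simp: space_gauss_measure)
qed

text \<open>The converse for a single code at fixed block length; the factor
  \<open>1 - \<epsilon>\<close> and the two Fano terms \<open>ln 2\<close> disappear only in the
  limit.\<close>

lemma code_bound:
  fixes P1 P2 h1 h2 \<rho> \<eta> :: real
  assumes P: "0 \<le> P1" "0 \<le> P2" and \<rho>\<eta>: "\<eta> \<noteq> 0" "\<eta>\<^sup>2 \<le> 1 - \<rho>\<^sup>2" and n: "1 \<le> n"
    and code: "is_code P1 P2 n R f g"
  defines "M \<equiv> \<lambda>s. message_set n (R $ s)" and "\<epsilon> \<equiv> error_prob h1 h2 n R f g" and "I \<equiv> INR P1 P2 h1 h2"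
  shows "(1 - \<epsilon>) * (\<Sum>s\<in>UNIV. ln (card (M s))) - 2 * ln 2 \<le>
    n * ln (1 + 1 / \<eta>\<^sup>2 * (I + bound_A P1 P2 h1 h2 \<rho> \<eta> / (1 - \<rho>\<^sup>2 + I)))"
proof -
  have finM: "finite (M s)" "M s \<noteq> {}" for s
    by (simp_all add: M_def finite_message_set message_set_nonempty)
  have cardM: "0 < real (card (M s))" for s
    using finM[of s] by (simp add: card_gt_0_iff)
  have \<eta>2: "0 < \<eta>\<^sup>2" using \<rho>\<eta> by simp
  then have \<rho>: "\<rho>\<^sup>2 < 1" using \<rho>\<eta>(2) by linarith
  have I0: "0 \<le> I" using P by (simp add: I_def INR_def)
  \<comment> \<open>Centring: \<open>\<mu> s t\<close> is the mean input of transmitter s at time t,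
    and subtracting it can only lower the second moment.\<close>
  define \<mu> where "\<mu> s t = (\<Sum>m\<in>M s. f s m t) / card (M s)" for s t
  define x where "x s m t = f s m t - \<mu> s t" for s m t
  have cent: "(\<Sum>m\<in>M s. x s m t) = 0" for s t
    using cardM[of s] by (simp add: x_def \<mu>_def sum_subtractf)
  have power: "(\<Sum>m\<in>M s. \<Sum>t<n. (x s m t)\<^sup>2) \<le> card (M s) * (n * tx_power P1 P2 s)" for s
  proof -
    have "(\<Sum>m\<in>M s. (x s m t)\<^sup>2) \<le> (\<Sum>m\<in>M s. (f s m t)\<^sup>2)" for t
    proof -
      have "(f s m t)\<^sup>2 = (x s m t)\<^sup>2 + (2 * \<mu> s t * x s m t + (\<mu> s t)\<^sup>2)" for m
        by (simp add: x_def power2_eq_square algebra_simps)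
      then have "(\<Sum>m\<in>M s. (f s m t)\<^sup>2) = (\<Sum>m\<in>M s. (x s m t)\<^sup>2) + card (M s) * (\<mu> s t)\<^sup>2"
        by (simp add: sum.distrib sum_distrib_left[symmetric] cent)
      then show ?thesis by simp
    qed
    then have "(\<Sum>t<n. \<Sum>m\<in>M s. (x s m t)\<^sup>2) \<le> (\<Sum>t<n. \<Sum>m\<in>M s. (f s m t)\<^sup>2)"
      by (rule sum_mono)
    also have "\<dots> = card (M s) * (\<Sum>t<n. measure_pmf.expectation (message_law n (R $ s)) (\<lambda>m. (f s m t)\<^sup>2))"
      using finM[of s] cardM[of s] unfolding message_law_def M_def
      by (simp add: integral_pmf_of_set sum_divide_distrib[symmetric])
    also have "\<dots> \<le> card (M s) * (n * tx_power P1 P2 s)"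
    proof (intro mult_left_mono)
      have "(\<Sum>t<n. measure_pmf.expectation (message_law n (R $ s)) (\<lambda>m. (f s m t)\<^sup>2)) / n \<le> tx_power P1 P2 s"
        using code by (simp add: is_code_def)
      then show "(\<Sum>t<n. measure_pmf.expectation (message_law n (R $ s)) (\<lambda>m. (f s m t)\<^sup>2)) \<le> n * tx_power P1 P2 s"
        using n by (simp add: divide_le_eq mult.commute)
    qed simp
    finally show ?thesis by (subst sum.swap)
  qed
  have power': "(\<Sum>m\<in>M 1. \<Sum>t<n. (x 1 m t)\<^sup>2) \<le> card (M 1) * (n * P1)"
      "(\<Sum>m\<in>M 2. \<Sum>t<n. (x 2 m t)\<^sup>2) \<le> card (M 2) * (n * P2)"
      "(\<Sum>m\<in>M 3. \<Sum>t<n. (x 3 m t)\<^sup>2) \<le> card (M 3) * (n * P1)"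
      "(\<Sum>m\<in>M 4. \<Sum>t<n. (x 4 m t)\<^sup>2) \<le> card (M 4) * (n * P2)"
    using power[of 1] power[of 2] power[of 3] power[of 4] by (simp_all add: tx_power_def)
  \<comment> \<open>The contributions of the means to the two outputs. \<open>G\<close> adds them
    back before decoding, so its decisions agree with those of the original code.\<close>
  define e1 where "e1 t = \<mu> 1 t + \<mu> 2 t + h1 * \<mu> 3 t + h2 * \<mu> 4 t" for t
  define e2 where "e2 t = h1 * \<mu> 1 t + h2 * \<mu> 2 t + \<mu> 3 t + \<mu> 4 t" for t
  define G where "G i j e y = (g i (restrict (\<lambda>t. y t + e t) {..<n}), g j (restrict (\<lambda>t. y t + e t) {..<n}))"
    for i j and e y :: "nat \<Rightarrow> real"
  have Gm: "G i j e \<in> block_lborel n \<rightarrow>\<^sub>M count_space UNIV" for i j e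
  proof -
    have gm: "g s \<in> block_lborel n \<rightarrow>\<^sub>M count_space UNIV" for s
    proof -
      have "g s \<in> block_lborel n \<rightarrow>\<^sub>M count_space (M s)"
        unfolding measurable_cong_sets[OF sets_block_lborel refl] using code by (simp add: is_code_def M_def)
      from measurable_compose[OF this, of "\<lambda>x. x" "count_space UNIV"] show ?thesis by simp
    qed
    have "(\<lambda>y. restrict (\<lambda>t. y t + e t) {..<n}) \<in> block_lborel n \<rightarrow>\<^sub>M block_lborel n"
      by (intro measurable_block_restrict borel_measurable_add borel_measurable_const block_component_measurable)
    from measurable_Pair[OF measurable_compose[OF this gm] measurable_compose[OF this gm]]
    show ?thesis unfolding G_def by (simp add: pair_measure_countable)
  qed
  let ?Err = "\<lambda>m. {z \<in> space (noise_pair n 1 1). \<exists>s. decoded h1 h2 n f g (m, z) s \<noteq> m s}"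
  have ErrS: "?Err m \<in> sets (noise_pair n 1 1)" for m
    using decoding_error_measurable[OF code, of h1 h2 m 1 1] by (simp add: pred_def)
  let ?S = "\<lambda>i j e w p. {z \<in> space (gauss_measure n 1). G i j e (restrict (\<lambda>t. w t + z t) {..<n}) \<noteq> p}"
  have S: "?S i j e w p \<in> sets (gauss_measure n 1)" for i j e w p
  proof -
    have "(\<lambda>z. restrict (\<lambda>t. w t + z t) {..<n}) \<in> gauss_measure n 1 \<rightarrow>\<^sub>M block_lborel n"
      by (intro measurable_block_restrict)
        (simp add: gauss_measure_def block_component_measurable borel_measurable_add)
    from measurable_sets[OF measurable_compose[OF this Gm], of "- {p}"] show ?thesis
      by (simp add: vimage_def Int_def conj_commute)
  qed
  let ?w = "\<lambda>i j k l (a :: nat \<times> nat) (b :: nat \<times> nat) t.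
    x i (fst a) t + x j (snd a) t + (h1 * x k (fst b) t + h2 * x l (snd b) t)"
  have idx: "distinct [1, 2, 3, 4 :: 4]" "UNIV = {1, 2, 3, 4 :: 4}" "distinct [3, 4, 1, 2 :: 4]" "UNIV = {3, 4, 1, 2 :: 4}"
    using UNIV_4 by (simp, blast, simp, blast)
  have err1: "(\<Sum>(a, b)\<in>(M 1 \<times> M 2) \<times> (M 3 \<times> M 4). measure (gauss_measure n 1) (?S 1 2 e1 (?w 1 2 3 4 a b) a))
      / (card (M 1 \<times> M 2) * card (M 3 \<times> M 4)) \<le> \<epsilon>"
    unfolding \<epsilon>_def M_def
  proof (rule receiver_error_le[OF idx(1,2) code], unfold prod.case)
    fix m
    have dec: "(decoded h1 h2 n f g (m, z) 1, decoded h1 h2 n f g (m, z) 2) = G 1 2 e1 (restrict (\<lambda>t. ?w 1 2 3 4 (m 1, m 2) (m 3, m 4) t + fst z t) {..<n})" for z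
    proof -
      have "restrict (\<lambda>t. restrict (\<lambda>t. ?w 1 2 3 4 (m 1, m 2) (m 3, m 4) t + fst z t) {..<n} t + e1 t) {..<n}
          = output1 n h1 h2 (\<lambda>j. f j (m j)) (fst z)"
        unfolding output1_def by (intro restrict_ext) (simp add: x_def e1_def algebra_simps)
      then show ?thesis by (simp add: decoded_def split_beta G_def)
    qed
    have "?S 1 2 e1 (?w 1 2 3 4 (m 1, m 2) (m 3, m 4)) (m 1, m 2) \<times> space (block_lborel n) \<subseteq> ?Err m"
    proof
      fix z assume z: "z \<in> ?S 1 2 e1 (?w 1 2 3 4 (m 1, m 2) (m 3, m 4)) (m 1, m 2) \<times> space (block_lborel n)"
      then have "G 1 2 e1 (restrict (\<lambda>t. ?w 1 2 3 4 (m 1, m 2) (m 3, m 4) t + fst z t) {..<n}) \<noteq> (m 1, m 2)" by auto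
      then have "\<exists>s. decoded h1 h2 n f g (m, z) s \<noteq> m s"
        unfolding dec[symmetric] by blast
      with z show "z \<in> ?Err m" by (auto simp: space_pair_measure space_gauss_measure)
    qed
    then show "measure (gauss_measure n 1) (?S 1 2 e1 (?w 1 2 3 4 (m 1, m 2) (m 3, m 4)) (m 1, m 2)) \<le>
        measure (noise_pair n 1 1) (?Err m)"
      by (rule measure_gauss_le_noise_pair(1)[OF ErrS S])
  qed
  have err2: "(\<Sum>(a, b)\<in>(M 3 \<times> M 4) \<times> (M 1 \<times> M 2). measure (gauss_measure n 1) (?S 3 4 e2 (?w 3 4 1 2 a b) a))
      / (card (M 3 \<times> M 4) * card (M 1 \<times> M 2)) \<le> \<epsilon>"
    unfolding \<epsilon>_def M_def
  proof (rule receiver_error_le[OF idx(3,4) code], unfold prod.case)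
    fix m
    have dec: "(decoded h1 h2 n f g (m, z) 3, decoded h1 h2 n f g (m, z) 4) = G 3 4 e2 (restrict (\<lambda>t. ?w 3 4 1 2 (m 3, m 4) (m 1, m 2) t + snd z t) {..<n})" for z
    proof -
      have "restrict (\<lambda>t. restrict (\<lambda>t. ?w 3 4 1 2 (m 3, m 4) (m 1, m 2) t + snd z t) {..<n} t + e2 t) {..<n}
          = output2 n h1 h2 (\<lambda>j. f j (m j)) (snd z)"
        unfolding output2_def by (intro restrict_ext) (simp add: x_def e2_def algebra_simps)
      then show ?thesis by (simp add: decoded_def split_beta G_def)
    qed
    have "space (block_lborel n) \<times> ?S 3 4 e2 (?w 3 4 1 2 (m 3, m 4) (m 1, m 2)) (m 3, m 4) \<subseteq> ?Err m"
    proof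
      fix z assume z: "z \<in> space (block_lborel n) \<times> ?S 3 4 e2 (?w 3 4 1 2 (m 3, m 4) (m 1, m 2)) (m 3, m 4)"
      then have "G 3 4 e2 (restrict (\<lambda>t. ?w 3 4 1 2 (m 3, m 4) (m 1, m 2) t + snd z t) {..<n}) \<noteq> (m 3, m 4)" by auto
      then have "\<exists>s. decoded h1 h2 n f g (m, z) s \<noteq> m s"
        unfolding dec[symmetric] by blast
      with z show "z \<in> ?Err m" by (auto simp: space_pair_measure space_gauss_measure)
    qed
    then show "measure (gauss_measure n 1) (?S 3 4 e2 (?w 3 4 1 2 (m 3, m 4) (m 1, m 2)) (m 3, m 4)) \<le>
        measure (noise_pair n 1 1) (?Err m)"
      by (rule measure_gauss_le_noise_pair(2)[OF ErrS S])
  qed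
  let ?v = "\<lambda>i j a t. h1 * x i (fst a) t + h2 * x j (snd a) t"
  let ?H = "\<lambda>p i j. mixture_entropy n p (M i \<times> M j) (?v i j)"
  define c where "c = (h1 * P1 + h2 * P2 + \<rho> * \<eta>) / (I + \<eta>\<^sup>2)"
  let ?\<sigma> = "genie_variance P1 P2 h1 h2 \<rho> \<eta> c" and ?q = "1 - \<rho>\<^sup>2"
  have 1: "(1 - \<epsilon>) * ln (card (M 1 \<times> M 2)) - ln 2 \<le> ?H (\<eta>\<^sup>2) 1 2 - ?H ?q 3 4 + n / 2 * ln (?\<sigma> / \<eta>\<^sup>2)"
    by (rule receiver_bound[OF \<rho>\<eta>(1) \<rho> P finM finM finM finM cent cent cent power' Gm err1])
  have 2: "(1 - \<epsilon>) * ln (card (M 3 \<times> M 4)) - ln 2 \<le> ?H (\<eta>\<^sup>2) 3 4 - ?H ?q 1 2 + n / 2 * ln (?\<sigma> / \<eta>\<^sup>2)"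
    by (rule receiver_bound[OF \<rho>\<eta>(1) \<rho> P finM finM finM finM cent cent cent power'(3,4,1,2) Gm err2])
  have inc: "?H (\<eta>\<^sup>2) i j - ?H ?q i j \<le> n / 2 * ln ((I + \<eta>\<^sup>2) / (I + ?q))"
    if p: "(\<Sum>m\<in>M i. \<Sum>t<n. (x i m t)\<^sup>2) \<le> card (M i) * (n * P1)"
      "(\<Sum>m\<in>M j. \<Sum>t<n. (x j m t)\<^sup>2) \<le> card (M j) * (n * P2)" for i j
  \<comment> \<open>Equality in the constraint leaves no noise to add; it is separate because the
    increment lemma needs positive added variance.\<close>
  proof (cases "\<eta>\<^sup>2 = ?q")
    case True
    then have "(I + \<eta>\<^sup>2) / (I + ?q) = 1" using I0 \<eta>2 by simp
    with True show ?thesis by simp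
  next
    case False
    then have "0 < ?q - \<eta>\<^sup>2" using \<rho>\<eta>(2) by simp
    moreover have "(\<Sum>a\<in>M i \<times> M j. \<Sum>t<n. (?v i j a t)\<^sup>2) \<le> card (M i \<times> M j) * (n * I)"
      unfolding I_def INR_def by (rule sum_squares_codebooks_le[OF cent p])
    ultimately have "?H (\<eta>\<^sup>2) i j - ?H (\<eta>\<^sup>2 + (?q - \<eta>\<^sup>2)) i j
        \<le> n / 2 * ln ((I + \<eta>\<^sup>2) / (I + (\<eta>\<^sup>2 + (?q - \<eta>\<^sup>2))))"
      using \<eta>2 I0 finM by (intro mixture_entropy_increment) auto
    then show ?thesis by simp
  qed
  have card: "ln (card (M i \<times> M j)) = ln (card (M i)) + ln (card (M j))" for i j
    using cardM[of i] cardM[of j] by (simp add: card_cartesian_product ln_mult)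
  have "(1 - \<epsilon>) * (\<Sum>s\<in>UNIV. ln (card (M s))) - 2 * ln 2 =
      ((1 - \<epsilon>) * ln (card (M 1 \<times> M 2)) - ln 2) + ((1 - \<epsilon>) * ln (card (M 3 \<times> M 4)) - ln 2)"
    by (simp only: card sum_4) (simp add: algebra_simps)
  \<comment> \<open>The entropies regroup by transmitter pair, each paying one increment; the two
    contributions of \<open>n / 2\<close> add up to n.\<close>
  also have "\<dots> \<le> n * (ln ((I + \<eta>\<^sup>2) / (I + ?q)) + ln (?\<sigma> / \<eta>\<^sup>2))"
    using 1 2 inc[OF power'(1,2)] inc[OF power'(3,4)] by (simp add: distrib_left)
  also have "ln ((I + \<eta>\<^sup>2) / (I + ?q)) + ln (?\<sigma> / \<eta>\<^sup>2) = ln ((I + \<eta>\<^sup>2) / (I + ?q) * (?\<sigma> / \<eta>\<^sup>2))"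
  proof (rule ln_mult_pos[symmetric])
    show "0 < (I + \<eta>\<^sup>2) / (I + ?q)"
      using I0 \<eta>2 \<rho> by (intro divide_pos_pos) linarith+
    have "0 < ?\<sigma>"
      using P I0 \<rho> by (auto simp: genie_variance_def I_def intro!: add_nonneg_pos add_nonneg_nonneg)
    then show "0 < ?\<sigma> / \<eta>\<^sup>2" using \<eta>2 by simp
  qed
  also have "(I + \<eta>\<^sup>2) / (I + ?q) * (?\<sigma> / \<eta>\<^sup>2) =
      1 + 1 / \<eta>\<^sup>2 * (I + bound_A P1 P2 h1 h2 \<rho> \<eta> / (1 - \<rho>\<^sup>2 + I))"
    unfolding c_def I_def by (rule genie_variance_optimal[OF P \<rho>\<eta>(1) \<rho>])
  finally show ?thesis .
qed

section \<open>The minimum and the sum capacity\<close>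

definition bound_arg :: "real \<Rightarrow> real \<Rightarrow> real \<Rightarrow> real \<Rightarrow> real \<Rightarrow> real \<Rightarrow> real" where
  "bound_arg P1 P2 h1 h2 \<rho> \<eta> = 1 + 1 / \<eta>\<^sup>2 * (INR P1 P2 h1 h2 +
     bound_A P1 P2 h1 h2 \<rho> \<eta> / (1 - \<rho>\<^sup>2 + INR P1 P2 h1 h2))"

lemma bound_values_eq:
  "bound_values P1 P2 h1 h2 = {log 2 (bound_arg P1 P2 h1 h2 \<rho> \<eta>) | \<rho> \<eta>. \<eta> \<noteq> 0 \<and> \<eta>\<^sup>2 \<le> 1 - \<rho>\<^sup>2}"
proof -
  have "\<rho> \<in> {-1..1}" if "\<eta>\<^sup>2 \<le> 1 - \<rho>\<^sup>2" for \<rho> \<eta> :: real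
  proof -
    have "\<rho>\<^sup>2 \<le> 1" using that zero_le_power2[of \<eta>] by linarith
    then show ?thesis using abs_le_square_iff[of \<rho> 1] by auto
  qed
  then show ?thesis unfolding bound_values_def bound_arg_def by blast
qed

text \<open>The dropped term with \<open>bound_A\<close> is nonnegative, and what remains is
  coercive as \<eta> tends to 0 when \<open>INR\<close> is positive.\<close>

lemma bound_arg_ge:
  assumes "0 \<le> P1" "0 \<le> P2" "\<eta>\<^sup>2 \<le> 1 - \<rho>\<^sup>2"
  shows "1 + INR P1 P2 h1 h2 / \<eta>\<^sup>2 \<le> bound_arg P1 P2 h1 h2 \<rho> \<eta>"
proof -
  have "0 \<le> INR P1 P2 h1 h2" "0 \<le> bound_A P1 P2 h1 h2 \<rho> \<eta>"
    using assms by (simp_all add: INR_def bound_A_def)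
  moreover have "0 \<le> 1 - \<rho>\<^sup>2" using assms(3) zero_le_power2[of \<eta>] by linarith
  ultimately show ?thesis
    by (simp add: bound_arg_def divide_right_mono add_nonneg_nonneg)
qed

lemma bound_arg_ge_1:
  assumes "0 \<le> P1" "0 \<le> P2" "\<eta>\<^sup>2 \<le> 1 - \<rho>\<^sup>2"
  shows "1 \<le> bound_arg P1 P2 h1 h2 \<rho> \<eta>"
proof -
  have "0 \<le> INR P1 P2 h1 h2 / \<eta>\<^sup>2" using assms by (simp add: INR_def)
  then show ?thesis using bound_arg_ge[OF assms, of h1 h2] by linarith
qed

text \<open>
  If \<open>INR > 0\<close>, the expression blows up as \<open>\<eta>\<close> tends to \<open>0\<close>, so the minimum is taken over a compact
  set; if \<open>INR = 0\<close>, it does not depend on \<open>\<eta>\<close> and is smallest at \<open>\<rho> = 0\<close>.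
\<close>

lemma bound_arg_attains_min:
  assumes P: "0 \<le> P1" "0 \<le> P2"
  obtains \<rho>0 \<eta>0 where "\<eta>0 \<noteq> 0" "\<eta>0\<^sup>2 \<le> 1 - \<rho>0\<^sup>2"
    "\<And>\<rho> \<eta>. \<eta> \<noteq> 0 \<Longrightarrow> \<eta>\<^sup>2 \<le> 1 - \<rho>\<^sup>2 \<Longrightarrow> bound_arg P1 P2 h1 h2 \<rho>0 \<eta>0 \<le> bound_arg P1 P2 h1 h2 \<rho> \<eta>"
proof (cases "INR P1 P2 h1 h2 = 0")
  case True
  then have z: "h1\<^sup>2 * P1 = 0" "h2\<^sup>2 * P2 = 0"
    using P by (auto simp: INR_def add_nonneg_eq_0_iff)
  have A: "bound_A P1 P2 h1 h2 \<rho> \<eta> = (P1 + P2) * \<eta>\<^sup>2" for \<rho> \<eta>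
    using z unfolding bound_A_def by (auto simp: power2_eq_square algebra_simps)
  have X: "bound_arg P1 P2 h1 h2 \<rho> \<eta> = 1 + (P1 + P2) / (1 - \<rho>\<^sup>2)" if "\<eta> \<noteq> 0" for \<rho> \<eta>
    using that by (simp add: bound_arg_def True A)
  show ?thesis
  \<comment> \<open>Terms are instantiated in order of occurrence: \<open>\<eta>0\<close> is 1 and
    \<open>\<rho>0\<close> is 0.\<close>
  proof (rule that[of 1 0])
    fix \<rho> \<eta> :: real assume "\<eta> \<noteq> 0" and le: "\<eta>\<^sup>2 \<le> 1 - \<rho>\<^sup>2"
    then have "0 < \<eta>\<^sup>2" by simp
    with le have "0 < 1 - \<rho>\<^sup>2" by linarith
    moreover have "1 - \<rho>\<^sup>2 \<le> 1" by simp
    ultimately have "(P1 + P2) / 1 \<le> (P1 + P2) / (1 - \<rho>\<^sup>2)"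
      using P by (intro divide_left_mono) auto
    then show "bound_arg P1 P2 h1 h2 0 1 \<le> bound_arg P1 P2 h1 h2 \<rho> \<eta>"
      using \<open>\<eta> \<noteq> 0\<close> by (simp add: X)
  qed simp_all
next
  case False
  let ?I = "INR P1 P2 h1 h2" and ?X = "\<lambda>p. bound_arg P1 P2 h1 h2 (fst p) (snd p)"
  have I: "0 < ?I" using False P by (simp add: INR_def order_less_le)
  have X0: "1 + ?I \<le> ?X (0, 1)" using bound_arg_ge[OF P, of 1 0 h1 h2] by simp
  \<comment> \<open>For \<open>\<eta>\<^sup>2 < \<delta>\<close> the term
    \<open>?I / \<eta>\<^sup>2\<close> alone exceeds the value at \<open>(0, 1)\<close>, so such
    points cannot compete.\<close>
  define \<delta> where "\<delta> = ?I / ?X (0, 1)"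
  have \<delta>: "0 < \<delta>" "\<delta> \<le> 1" using I X0 by (simp_all add: \<delta>_def)
  \<comment> \<open>The constraint describes the closed unit disc; a strip around \<eta> = 0 is cut
    out of it.\<close>
  define K where "K = cball 0 1 \<inter> {p :: real \<times> real. \<delta> \<le> (snd p)\<^sup>2}"
  have K: "p \<in> K \<longleftrightarrow> (snd p)\<^sup>2 \<le> 1 - (fst p)\<^sup>2 \<and> \<delta> \<le> (snd p)\<^sup>2" for p
    by (cases p) (auto simp: K_def norm_Pair)
  have "compact K"
    unfolding K_def by (intro compact_Int_closed compact_cball closed_Collect_le continuous_intros)
  moreover have "K \<noteq> {}"
    using \<delta> K[of "(0, 1)"] by auto
  moreover have "continuous_on K ?X"
  proof -
    have "snd p \<noteq> 0" "1 - (fst p)\<^sup>2 + ?I \<noteq> 0" if "p \<in> K" for p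
      using that I \<delta> zero_le_power2[of "snd p"] unfolding K by auto
    then show ?thesis
      unfolding bound_arg_def bound_A_def by (intro continuous_intros) auto
  qed
  ultimately obtain p where p: "p \<in> K" "\<And>q. q \<in> K \<Longrightarrow> ?X p \<le> ?X q"
    using continuous_attains_inf[of K ?X] by blast
  show ?thesis
  proof (rule that[of "snd p" "fst p"])
    show "snd p \<noteq> 0" "(snd p)\<^sup>2 \<le> 1 - (fst p)\<^sup>2" using p(1) \<delta> by (auto simp: K)
    fix \<rho> \<eta> :: real assume \<eta>: "\<eta> \<noteq> 0" "\<eta>\<^sup>2 \<le> 1 - \<rho>\<^sup>2"
    show "?X p \<le> bound_arg P1 P2 h1 h2 \<rho> \<eta>"
    proof (cases "\<delta> \<le> \<eta>\<^sup>2")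
      case True
      then show ?thesis using p(2)[of "(\<rho>, \<eta>)"] \<eta> by (simp add: K)
    next
      case False
      then have "?X (0, 1) \<le> ?I / \<eta>\<^sup>2"
        using I X0 \<eta>(1) by (simp add: \<delta>_def field_simps)
      moreover have "?X p \<le> ?X (0, 1)" using p(2)[of "(0, 1)"] \<delta> by (simp add: K)
      ultimately show ?thesis using bound_arg_ge[OF P \<eta>(2), of h1 h2] by linarith
    qed
  qed
qed

section \<open>From codes to the capacity region\<close>

lemma achievable_sum_rate_le:
  assumes P: "0 \<le> P1" "0 \<le> P2" and R: "achievable P1 P2 h1 h2 R" and v: "v \<in> bound_values P1 P2 h1 h2"
  shows "sum_rate R \<le> v"
proof -
  obtain \<rho> \<eta> where \<rho>\<eta>: "\<eta> \<noteq> 0" "\<eta>\<^sup>2 \<le> 1 - \<rho>\<^sup>2" and v: "v = log 2 (bound_arg P1 P2 h1 h2 \<rho> \<eta>)"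
    using v by (auto simp: bound_values_eq)
  obtain f g where code: "\<And>n. 1 \<le> n \<Longrightarrow> is_code P1 P2 n R (f n) (g n)"
    and lim: "(\<lambda>n. error_prob h1 h2 n R (f n) (g n)) \<longlonglongrightarrow> 0"
    using R by (auto simp: achievable_def)
  let ?e = "\<lambda>n. error_prob h1 h2 n R (f n) (g n)"
  let ?K = "ln (bound_arg P1 P2 h1 h2 \<rho> \<eta>)"
  \<comment> \<open>Only with \<open>1 - ?e n\<close> nonnegative can the lower bound on the message
    set sizes be multiplied by it.\<close>
  have "\<forall>\<^sub>F n in sequentially. ?e n < 1"
    using lim by (rule order_tendstoD) simp
  with eventually_ge_at_top[of 1]
  have ev: "\<forall>\<^sub>F n in sequentially. (1 - ?e n) * (sum_rate R * ln 2) \<le> ?K + 2 * ln 2 * inverse (real n)"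
  proof eventually_elim
    fix n :: nat assume n: "1 \<le> n" and e: "?e n < 1"
    have "(1 - ?e n) * (n * (sum_rate R * ln 2)) = (1 - ?e n) * (\<Sum>s\<in>UNIV. n * R $ s * ln 2)"
      by (simp add: sum_rate_def sum_distrib_left sum_distrib_right mult_ac)
    also have "\<dots> \<le> (1 - ?e n) * (\<Sum>s\<in>UNIV. ln (card (message_set n (R $ s))))"
      using e by (intro mult_left_mono sum_mono ln_card_message_set) simp
    also have "\<dots> \<le> n * ?K + 2 * ln 2"
      using code_bound[OF P \<rho>\<eta> n code[OF n], of h1 h2] by (simp add: bound_arg_def)
    also have "\<dots> = n * (?K + 2 * ln 2 * inverse n)"
      using n by (simp add: distrib_left)
    finally have "n * ((1 - ?e n) * (sum_rate R * ln 2)) \<le> n * (?K + 2 * ln 2 * inverse n)"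
      by (simp only: mult.left_commute[of "1 - ?e n"])
    then show "(1 - ?e n) * (sum_rate R * ln 2) \<le> ?K + 2 * ln 2 * inverse n"
      using n by simp
  qed
  have "sum_rate R * ln 2 \<le> ?K"
  proof (rule tendsto_le[OF _ _ _ ev])
    have "(\<lambda>n. ?K + 2 * ln 2 * inverse (real n)) \<longlonglongrightarrow> ?K + 2 * ln 2 * 0"
      by (intro tendsto_intros lim_inverse_n)
    then show "(\<lambda>n. ?K + 2 * ln 2 * inverse (real n)) \<longlonglongrightarrow> ?K" by simp
    have "(\<lambda>n. (1 - ?e n) * (sum_rate R * ln 2)) \<longlonglongrightarrow> (1 - 0) * (sum_rate R * ln 2)"
      by (intro tendsto_intros lim)
    then show "(\<lambda>n. (1 - ?e n) * (sum_rate R * ln 2)) \<longlonglongrightarrow> sum_rate R * ln 2" by simp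
  qed simp
  then show ?thesis by (simp add: v log_def le_divide_eq)
qed

text \<open>At rate zero each transmitter has a single message, so constant decoders do not err.
  This makes the region nonempty, as needed for a maximum to exist.\<close>

lemma achievable_zero:
  assumes "0 \<le> P1" "0 \<le> P2"
  shows "achievable P1 P2 h1 h2 0"
proof -
  let ?f = "\<lambda>_ _ _. 0 :: real" and ?g = "\<lambda>_ _. 1 :: nat"
  have M: "message_set n 0 = {1}" for n
    by (auto simp: message_set_def)
  have "is_code P1 P2 n 0 ?f ?g" if "1 \<le> n" for n
    using assms that by (simp add: is_code_def M tx_power_def)
  moreover have "error_prob h1 h2 n 0 ?f ?g = 0" for n
  proof -
    let ?P = "Pi_pmf UNIV 0 (\<lambda>i :: 4. message_law n (0 $ i))" and ?N = "noise_law n \<Otimes>\<^sub>M noise_law n"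
    interpret N: prob_space ?N
      unfolding noise_law_eq by (intro prob_space_noise_pair) simp_all
    \<comment> \<open>The formal error event consists of message tuples outside the support of the
      message law.\<close>
    have "{\<omega> \<in> space (imac_space n 0). \<exists>i. decoded h1 h2 n ?f ?g \<omega> i \<noteq> fst \<omega> i} =
        {m. \<exists>i. m i \<noteq> 1} \<times> space ?N"
      by (auto simp: imac_space_def space_pair_measure decoded_def split: if_splits) metis+
    moreover have "measure_pmf.prob ?P {m. \<exists>i. m i \<noteq> 1} = 0"
      unfolding measure_pmf_zero_iff by (auto simp: set_Pi_pmf PiE_dflt_def message_law_def M)
    then have "emeasure (measure_pmf ?P) {m. \<exists>i. m i \<noteq> 1} = 0"
      by (simp only: measure_pmf.emeasure_eq_measure ennreal_0)
    ultimately show ?thesis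
      by (simp add: error_prob_def measure_def imac_space_def N.emeasure_pair_measure_Times)
  qed
  ultimately show ?thesis
    unfolding achievable_def by (intro conjI exI[of _ "\<lambda>_. ?f"] exI[of _ "\<lambda>_. ?g"]) auto
qed

text \<open>Both conditions are closed and so survive the closure; nonnegativity is kept because it
  later gives boundedness.\<close>

lemma capacity_region_subset:
  assumes P: "0 \<le> P1" "0 \<le> P2" and v: "v \<in> bound_values P1 P2 h1 h2"
  shows "capacity_region P1 P2 h1 h2 \<subseteq> {R. (\<forall>i. 0 \<le> R $ i) \<and> sum_rate R \<le> v}"
  unfolding capacity_region_def
proof (rule closure_minimal)
  show "{R. achievable P1 P2 h1 h2 R} \<subseteq> {R. (\<forall>i. 0 \<le> R $ i) \<and> sum_rate R \<le> v}"
    using achievable_sum_rate_le[OF P _ v] by (auto simp: achievable_def)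
  show "closed {R. (\<forall>i. 0 \<le> R $ i) \<and> sum_rate R \<le> v}"
    unfolding sum_rate_def
    by (intro closed_Collect_conj closed_Collect_all closed_Collect_le continuous_intros)
qed

text \<open>The first four conjuncts certify that \<open>GREATEST\<close> and \<open>LEAST\<close>
  denote an attained maximum and minimum; otherwise the inequality might compare unspecified
  values.\<close>

theorem theorem4:
  fixes P1 P2 h1 h2 :: real
  assumes "P1 \<ge> 0" and "P2 \<ge> 0"
  shows "sum_capacity P1 P2 h1 h2 \<in> sum_rate ` capacity_region P1 P2 h1 h2 \<and>
         (\<forall>R\<in>capacity_region P1 P2 h1 h2. sum_rate R \<le> sum_capacity P1 P2 h1 h2) \<and>
         sum_capacity_bound P1 P2 h1 h2 \<in> bound_values P1 P2 h1 h2 \<and>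
         (\<forall>v\<in>bound_values P1 P2 h1 h2. sum_capacity_bound P1 P2 h1 h2 \<le> v) \<and>
         sum_capacity P1 P2 h1 h2 \<le> sum_capacity_bound P1 P2 h1 h2"
proof -
  let ?C = "capacity_region P1 P2 h1 h2" and ?V = "bound_values P1 P2 h1 h2"
  obtain \<rho> \<eta> where \<rho>\<eta>: "\<eta> \<noteq> 0" "\<eta>\<^sup>2 \<le> 1 - \<rho>\<^sup>2"
    and min: "\<And>\<rho>' \<eta>'. \<eta>' \<noteq> 0 \<Longrightarrow> \<eta>'\<^sup>2 \<le> 1 - \<rho>'\<^sup>2 \<Longrightarrow> bound_arg P1 P2 h1 h2 \<rho> \<eta> \<le> bound_arg P1 P2 h1 h2 \<rho>' \<eta>'"
    by (rule bound_arg_attains_min[OF assms, of h1 h2]) (rule that)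
  define b where "b = log 2 (bound_arg P1 P2 h1 h2 \<rho> \<eta>)"
  have b: "b \<in> ?V" unfolding bound_values_eq b_def using \<rho>\<eta> by blast
  have b_le: "b \<le> v" if v: "v \<in> ?V" for v
  proof -
    obtain \<rho>' \<eta>' where "\<eta>' \<noteq> 0" "\<eta>'\<^sup>2 \<le> 1 - \<rho>'\<^sup>2" "v = log 2 (bound_arg P1 P2 h1 h2 \<rho>' \<eta>')"
      using v by (auto simp: bound_values_eq)
    then show ?thesis
      using min[of \<eta>' \<rho>'] bound_arg_ge_1[OF assms \<rho>\<eta>(2), of h1 h2] by (simp add: b_def)
  qed
  have bound: "sum_capacity_bound P1 P2 h1 h2 = b"
    unfolding sum_capacity_bound_def by (rule Least_equality) (use b b_le in auto)
  have sub: "?C \<subseteq> {R. (\<forall>i. 0 \<le> R $ i) \<and> sum_rate R \<le> b}"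
    by (rule capacity_region_subset[OF assms b])
  \<comment> \<open>On nonnegative tuples the sum rate is the l1 norm, so bounding it bounds the
    region; being also closed, the region is compact and the maximum is attained.\<close>
  have "norm R \<le> b" if "R \<in> ?C" for R
  proof -
    have "norm R \<le> (\<Sum>i\<in>UNIV. \<bar>R $ i\<bar>)" by (rule norm_le_l1_cart)
    also have "\<dots> = sum_rate R" unfolding sum_rate_def using sub that
      by (intro sum.cong refl abs_of_nonneg) blast
    also have "\<dots> \<le> b" using sub that by blast
    finally show ?thesis .
  qed
  then have "bounded ?C"
    unfolding bounded_iff by blast
  then have "compact ?C"
    unfolding compact_eq_bounded_closed by (simp add: capacity_region_def)
  moreover have "?C \<noteq> {}"
  proof -
    have "0 \<in> ?C"
      unfolding capacity_region_def
      by (rule subsetD[OF closure_subset]) (simp add: achievable_zero[OF assms])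
    then show ?thesis by blast
  qed
  moreover have "continuous_on ?C sum_rate"
    unfolding sum_rate_def by (intro continuous_intros)
  ultimately obtain R where R: "R \<in> ?C" "\<And>R'. R' \<in> ?C \<Longrightarrow> sum_rate R' \<le> sum_rate R"
    using continuous_attains_sup[of ?C sum_rate] by blast
  have cap: "sum_capacity P1 P2 h1 h2 = sum_rate R"
    unfolding sum_capacity_def
  proof (rule Greatest_equality)
    show "sum_rate R \<in> sum_rate ` ?C" using R(1) by (rule imageI)
    show "y \<le> sum_rate R" if "y \<in> sum_rate ` ?C" for y using that R(2) by blast
  qed
  show ?thesis
    unfolding cap bound
  proof (intro conjI ballI)
    show "sum_rate R \<in> sum_rate ` ?C" using R(1) by (rule imageI)
    show "sum_rate R \<le> b" using R(1) sub by blast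
  qed (fact R(2) b b_le)+
qed

end
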